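(* Let $d\in\mathbb N$. Let $\Theta:\mathbb Z^d\times\mathbb Z^d\times\mathbb Z^d\to\mathbb C$ be a tensor such that $$\sup_{j,k,\ell\in\mathbb Z^d}|\Theta(j,k,\ell)|\,\langle |j-k|+|j-\ell|\rangle^{2N}<\infty$$ for some $N\in\mathbb N$ with $N>d$, and let $b=\{b_k\}_{k\in\mathbb Z^d}\in c_0(\mathbb Z^d)$. Let $\mathcal T_\Theta$ be given by $$(\mathcal T_\Theta(f,g))_j=\sum_{k\in\mathbb Z^d}\sum_{\ell\in\mathbb Z^d}\Theta(j,k,\ell)f_kg_\ell,\qquad j\in\mathbb Z^d.$$ Then the bilinear commutators $$[\mathcal T_\Theta,b]_1(f,g)=\mathcal T_\Theta(bf,g)-b\,\mathcal T_\Theta(f,g),\qquad [\mathcal T_\Theta,b]_2(f,g)=\mathcal T_\Theta(f,bg)-b\,\mathcal T_\Theta(f,g)$$ are compact bilinear operators from $\ell^p(\mathbb Z^d)\times\ell^q(\mathbb Z^d)$ to $\ell^r(\mathbb Z^d)$ for any $1\le p,q\le\infty$ and $1\le r<\infty$ with $\frac1p+\frac1q=\frac1r$.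
   Context: For $k\in\mathbb Z^d$, $|k|$ is the Euclidean norm, and $\langle x\rangle=(1+|x|^2)^{1/2}$ for $x$ a vector or a real number. $c_0(\mathbb Z^d)$ is the space of complex sequences $\{b_k\}_{k\in\mathbb Z^d}$ with $b_k\to0$ as $|k|\to\infty$. Products of sequences such as $bf$ are pointwise: $(bf)_k=b_kf_k$. For normed spaces $X,Y,Z$, a bilinear operator $T:X\times Y\to Z$ is compact if the set $\{T(f,g):\|f\|_X,\|g\|_Y\le1\}$ is pre-compact in $Z$. *)

theory Defs
  imports "HOL-Analysis.Analysis"
begin

text \<open>
  The lattice \<open>\<int>\<^sup>d\<close> is the type \<^typ>\<open>int ^ 'd\<close> with \<open>d = CARD('d)\<close>.  Sequence spaces are
  defined over an arbitrary index type; exponents range over \<^typ>\<open>ennreal\<close>, so that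
  \<open>p = \<infinity>\<close> is allowed and \<open>1 / \<infinity> = 0\<close>.
\<close>

definition znorm :: "int ^ 'd \<Rightarrow> real" where
  "znorm k = norm ((\<chi> i. real_of_int (k $ i)) :: real ^ 'd)"

definition japanese_bracket :: "'a::real_normed_vector \<Rightarrow> real" where
  "japanese_bracket x = sqrt (1 + (norm x)\<^sup>2)"

definition c0_seqs :: "(int ^ 'd \<Rightarrow> complex) set" where
  "c0_seqs = {b. (b \<longlongrightarrow> 0) (filtercomap znorm at_top)}"

definition lp_space :: "ennreal \<Rightarrow> ('i \<Rightarrow> complex) set" where
  "lp_space p =
     (if p = \<infinity> then {f. bdd_above (range (\<lambda>i. norm (f i)))}
      else {f. (\<lambda>i. norm (f i) powr enn2real p) summable_on UNIV})"

definition lp_norm :: "ennreal \<Rightarrow> ('i \<Rightarrow> complex) \<Rightarrow> real" where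
  "lp_norm p f =
     (if p = \<infinity> then (SUP i. norm (f i))
      else (\<Sum>\<^sub>\<infinity>i. norm (f i) powr enn2real p) powr (1 / enn2real p))"

text \<open>
  Normed spaces of complex functions are given by a carrier set and a norm.  For such \<open>(Z, nZ)\<close>,
  \<open>norm_topology Z nZ\<close> is the topology of the metric \<open>nZ (f - g)\<close> on \<open>Z\<close>; that this is a metric
  for \<open>\<ell>\<^sup>r\<close> with \<open>1 \<le> r < \<infinity>\<close> is \<open>Metric_space_lp\<close> below.
\<close>

definition norm_topology :: "('i \<Rightarrow> complex) set \<Rightarrow> (('i \<Rightarrow> complex) \<Rightarrow> real) \<Rightarrow> ('i \<Rightarrow> complex) topology"
  where "norm_topology Z nZ = Metric_space.mtopology Z (\<lambda>f g. nZ (\<lambda>i. f i - g i))"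

definition bilinear_op ::
  "('i \<Rightarrow> complex) set \<Rightarrow> ('j \<Rightarrow> complex) set \<Rightarrow> ('k \<Rightarrow> complex) set \<Rightarrow>
   (('i \<Rightarrow> complex) \<Rightarrow> ('j \<Rightarrow> complex) \<Rightarrow> 'k \<Rightarrow> complex) \<Rightarrow> bool" where
  "bilinear_op X Y Z T \<longleftrightarrow>
     (\<forall>f\<in>X. \<forall>g\<in>Y. T f g \<in> Z) \<and>
     (\<forall>f\<in>X. \<forall>f'\<in>X. \<forall>g\<in>Y. T (\<lambda>i. f i + f' i) g = (\<lambda>k. T f g k + T f' g k)) \<and>
     (\<forall>f\<in>X. \<forall>g\<in>Y. \<forall>g'\<in>Y. T f (\<lambda>j. g j + g' j) = (\<lambda>k. T f g k + T f g' k)) \<and>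
     (\<forall>c. \<forall>f\<in>X. \<forall>g\<in>Y. T (\<lambda>i. c * f i) g = (\<lambda>k. c * T f g k)) \<and>
     (\<forall>c. \<forall>f\<in>X. \<forall>g\<in>Y. T f (\<lambda>j. c * g j) = (\<lambda>k. c * T f g k))"

definition compact_bilinear_op ::
  "('i \<Rightarrow> complex) set \<Rightarrow> (('i \<Rightarrow> complex) \<Rightarrow> real) \<Rightarrow>
   ('j \<Rightarrow> complex) set \<Rightarrow> (('j \<Rightarrow> complex) \<Rightarrow> real) \<Rightarrow>
   ('k \<Rightarrow> complex) set \<Rightarrow> (('k \<Rightarrow> complex) \<Rightarrow> real) \<Rightarrow>
   (('i \<Rightarrow> complex) \<Rightarrow> ('j \<Rightarrow> complex) \<Rightarrow> 'k \<Rightarrow> complex) \<Rightarrow> bool" where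
  "compact_bilinear_op X nX Y nY Z nZ T \<longleftrightarrow>
     bilinear_op X Y Z T \<and>
     compactin (norm_topology Z nZ)
       (norm_topology Z nZ closure_of {T f g | f g. f \<in> X \<and> g \<in> Y \<and> nX f \<le> 1 \<and> nY g \<le> 1})"

text \<open>
  The library's infinite sum is \<open>0\<close> for families that are not summable;
  \<open>tensor_sums_converge\<close> says that no sum in \<open>tensor_op\<close> falls under this convention.
\<close>

definition tensor_op ::
  "('i \<Rightarrow> 'i \<Rightarrow> 'i \<Rightarrow> complex) \<Rightarrow> ('i \<Rightarrow> complex) \<Rightarrow> ('i \<Rightarrow> complex) \<Rightarrow> 'i \<Rightarrow> complex" where
  "tensor_op \<Theta> f g j = (\<Sum>\<^sub>\<infinity>k. \<Sum>\<^sub>\<infinity>l. \<Theta> j k l * f k * g l)"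

definition tensor_sums_converge ::
  "('i \<Rightarrow> 'i \<Rightarrow> 'i \<Rightarrow> complex) \<Rightarrow> ('i \<Rightarrow> complex) \<Rightarrow> ('i \<Rightarrow> complex) \<Rightarrow> bool" where
  "tensor_sums_converge \<Theta> f g \<longleftrightarrow>
     (\<forall>j. (\<forall>k. (\<lambda>l. \<Theta> j k l * f k * g l) summable_on UNIV) \<and>
          (\<lambda>k. \<Sum>\<^sub>\<infinity>l. \<Theta> j k l * f k * g l) summable_on UNIV)"

definition commutator1 ::
  "(('i \<Rightarrow> complex) \<Rightarrow> ('i \<Rightarrow> complex) \<Rightarrow> 'i \<Rightarrow> complex) \<Rightarrow> ('i \<Rightarrow> complex) \<Rightarrow>
   ('i \<Rightarrow> complex) \<Rightarrow> ('i \<Rightarrow> complex) \<Rightarrow> 'i \<Rightarrow> complex" where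
  "commutator1 T b f g = (\<lambda>j. T (\<lambda>k. b k * f k) g j - b j * T f g j)"

definition commutator2 ::
  "(('i \<Rightarrow> complex) \<Rightarrow> ('i \<Rightarrow> complex) \<Rightarrow> 'i \<Rightarrow> complex) \<Rightarrow> ('i \<Rightarrow> complex) \<Rightarrow>
   ('i \<Rightarrow> complex) \<Rightarrow> ('i \<Rightarrow> complex) \<Rightarrow> 'i \<Rightarrow> complex" where
  "commutator2 T b f g = (\<lambda>j. T f (\<lambda>k. b k * g k) j - b j * T f g j)"


lemma powr_convex_nonneg:
  fixes u v x y P :: real
  assumes "1 \<le> P" "0 \<le> u" "0 \<le> v" "u + v = 1" "0 \<le> x" "0 \<le> y"
  shows "(u * x + v * y) powr P \<le> u * x powr P + v * y powr P"
proof -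
  have aux: "(t * z) powr P \<le> t * z powr P" if "0 \<le> t" "t \<le> 1" "0 \<le> z" for t z
  proof -
    have "t powr P \<le> t"
    proof (cases "t = 0")
      case False
      then show ?thesis using powr_mono'[of 1 P t] that assms(1) by simp
    qed auto
    then show ?thesis using that by (simp add: powr_mult mult_right_mono)
  qed
  show ?thesis
  proof (cases "x = 0 \<or> y = 0")
    case True
    then show ?thesis using aux[of u x] aux[of v y] assms by auto
  next
    case False
    then have "0 < x" "0 < y" using assms by auto
    moreover have "v \<le> 1" "1 - v = u" using assms by auto
    ultimately show ?thesis
      using convex_onD[OF powr_convex[OF assms(1)], of v x y] assms(3) by simp
  qed
qed

lemma minkowski_aux:
  fixes f g :: "'i \<Rightarrow> complex"
  assumes P: "1 \<le> P" and A: "0 < A" and B: "0 < B"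
    and f: "(\<lambda>i. norm (f i) powr P) summable_on UNIV" "(\<Sum>\<^sub>\<infinity>i. norm (f i) powr P) \<le> A powr P"
    and g: "(\<lambda>i. norm (g i) powr P) summable_on UNIV" "(\<Sum>\<^sub>\<infinity>i. norm (g i) powr P) \<le> B powr P"
  shows "(\<lambda>i. norm (f i + g i) powr P) summable_on UNIV"
    and "(\<Sum>\<^sub>\<infinity>i. norm (f i + g i) powr P) \<le> (A + B) powr P"
proof -
  define a where "a = (A + B) powr P * (A / (A + B)) / A powr P"
  define b where "b = (A + B) powr P * (B / (A + B)) / B powr P"
  have ab: "0 \<le> a" "0 \<le> b" using A B by (auto simp: a_def b_def)
  have pt: "norm (f i + g i) powr P \<le> a * norm (f i) powr P + b * norm (g i) powr P" for i
  proof -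
    let ?u = "A / (A + B)" and ?v = "B / (A + B)"
    let ?x = "norm (f i) / A" and ?y = "norm (g i) / B"
    have "norm (f i + g i) \<le> norm (f i) + norm (g i)" by (rule norm_triangle_ineq)
    also have "\<dots> = (A + B) * (?u * ?x + ?v * ?y)"
    proof -
      have "(A + B) * (A / (A + B) * (norm (f i) / A)) = norm (f i)"
        "(A + B) * (B / (A + B) * (norm (g i) / B)) = norm (g i)"
        using A B by simp_all
      then show ?thesis by (simp only: distrib_left)
    qed
    finally have "norm (f i + g i) powr P \<le> ((A + B) * (?u * ?x + ?v * ?y)) powr P"
      using P by (intro powr_mono2) auto
    also have "\<dots> = (A + B) powr P * (?u * ?x + ?v * ?y) powr P"
      using A B by (simp add: powr_mult)
    also have "\<dots> \<le> (A + B) powr P * (?u * ?x powr P + ?v * ?y powr P)"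
      using A B P by (intro mult_left_mono powr_convex_nonneg) (simp_all flip: add_divide_distrib)
    also have "\<dots> = a * norm (f i) powr P + b * norm (g i) powr P"
      using A B by (simp add: a_def b_def powr_divide distrib_left)
    finally show ?thesis .
  qed
  have s: "(\<lambda>i. a * norm (f i) powr P + b * norm (g i) powr P) summable_on UNIV"
    by (intro summable_on_add summable_on_cmult_right f g)
  show 1: "(\<lambda>i. norm (f i + g i) powr P) summable_on UNIV"
    by (rule summable_on_comparison_test[OF s]) (use pt in auto)
  have "(\<Sum>\<^sub>\<infinity>i. norm (f i + g i) powr P)
        \<le> (\<Sum>\<^sub>\<infinity>i. a * norm (f i) powr P + b * norm (g i) powr P)"
    by (rule infsum_mono[OF 1 s pt])
  also have "\<dots> = a * (\<Sum>\<^sub>\<infinity>i. norm (f i) powr P) + b * (\<Sum>\<^sub>\<infinity>i. norm (g i) powr P)"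
    by (subst infsum_add)
      (auto intro!: summable_on_cmult_right f g simp: infsum_cmult_right f g)
  also have "\<dots> \<le> a * A powr P + b * B powr P"
    by (intro add_mono mult_left_mono f g ab)
  also have "\<dots> = (A + B) powr P * (A / (A + B) + B / (A + B))"
    using A B by (simp add: a_def b_def distrib_left)
  also have "\<dots> = (A + B) powr P"
    using A B by (simp flip: add_divide_distrib)
  finally show "(\<Sum>\<^sub>\<infinity>i. norm (f i + g i) powr P) \<le> (A + B) powr P" .
qed

lemma enn2real_ge_1:
  assumes "1 \<le> p" "p < (\<infinity>::ennreal)"
  shows "1 \<le> enn2real p"
  using enn2real_mono[OF assms(1)] assms(2) by (simp only: enn2real_1 infinity_ennreal_def)

lemma lp_space_finite:
  "p < \<infinity> \<Longrightarrow> lp_space p = {f. (\<lambda>i. norm (f i) powr enn2real p) summable_on UNIV}"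
  by (auto simp: lp_space_def)

lemma lp_norm_finite:
  "p < \<infinity> \<Longrightarrow> lp_norm p f = (\<Sum>\<^sub>\<infinity>i. norm (f i) powr enn2real p) powr (1 / enn2real p)"
  by (auto simp: lp_norm_def)

lemma lp_norm_nonneg: "p < \<infinity> \<Longrightarrow> 0 \<le> lp_norm p f"
  by (simp add: lp_norm_finite)

lemma lp_norm_powr:
  assumes "1 \<le> p" "p < \<infinity>"
  shows "lp_norm p f powr enn2real p = (\<Sum>\<^sub>\<infinity>i. norm (f i) powr enn2real p)"
  using enn2real_ge_1[OF assms] assms
  by (simp add: lp_norm_finite powr_powr infsum_nonneg)

lemma lp_minkowski:
  assumes p: "1 \<le> p" "p < \<infinity>" and fg: "f \<in> lp_space p" "g \<in> lp_space p"
  shows "(\<lambda>i. f i + g i) \<in> lp_space p"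
    and "lp_norm p (\<lambda>i. f i + g i) \<le> lp_norm p f + lp_norm p g"
proof -
  let ?P = "enn2real p"
  have P: "1 \<le> ?P" using enn2real_ge_1[OF p] .
  have s: "(\<lambda>i. norm (f i) powr ?P) summable_on UNIV" "(\<lambda>i. norm (g i) powr ?P) summable_on UNIV"
    using fg p by (auto simp: lp_space_finite)
  have le: "(\<Sum>\<^sub>\<infinity>i. norm (h i) powr ?P) \<le> (lp_norm p h + e) powr ?P" if "0 < e" for h :: "'a \<Rightarrow> complex" and e
    using lp_norm_nonneg[OF p(2), of h] that P
    by (subst lp_norm_powr[OF p, symmetric]) (intro powr_mono2, auto)
  have pos: "0 < lp_norm p h + e" if "0 < e" for h :: "'a \<Rightarrow> complex" and e
    using lp_norm_nonneg[OF p(2), of h] that by simp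
  show "(\<lambda>i. f i + g i) \<in> lp_space p"
    using minkowski_aux(1)[OF P pos[of 1] pos[of 1] s(1) le s(2) le] p by (simp add: lp_space_finite)
  show "lp_norm p (\<lambda>i. f i + g i) \<le> lp_norm p f + lp_norm p g"
  proof (rule field_le_epsilon)
    fix e :: real assume "0 < e"
    then have e: "0 < e / 2" by simp
    let ?s = "lp_norm p f + e/2 + (lp_norm p g + e/2)"
    have "(\<Sum>\<^sub>\<infinity>i. norm (f i + g i) powr ?P) \<le> ?s powr ?P"
      by (rule minkowski_aux(2)[OF P pos[OF e] pos[OF e] s(1) le[OF e] s(2) le[OF e]])
    then have "lp_norm p (\<lambda>i. f i + g i) powr ?P \<le> ?s powr ?P"
      by (simp only: lp_norm_powr[OF p])
    moreover have "0 \<le> ?s" using pos[OF e, of f] pos[OF e, of g] by simp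
    ultimately have "lp_norm p (\<lambda>i. f i + g i) \<le> ?s"
      using P powr_less_mono2[of ?P ?s "lp_norm p (\<lambda>i. f i + g i)"] by force
    then show "lp_norm p (\<lambda>i. f i + g i) \<le> lp_norm p f + lp_norm p g + e" by simp
  qed
qed

lemma Metric_space_lp:
  assumes p: "1 \<le> p" "p < \<infinity>"
  shows "Metric_space (lp_space p) (\<lambda>f g. lp_norm p (\<lambda>i. f i - g i))"
proof
  let ?P = "enn2real p"
  have P: "1 \<le> ?P" using enn2real_ge_1[OF p] .
  have minus: "(\<lambda>i. - g i) \<in> lp_space p" if "g \<in> lp_space p" for g :: "'a \<Rightarrow> complex"
    using that p by (simp add: lp_space_finite)
  have diff: "(\<lambda>i. f i - g i) \<in> lp_space p" if "f \<in> lp_space p" "g \<in> lp_space p" for f g :: "'a \<Rightarrow> complex"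
    using lp_minkowski(1)[OF p that(1) minus[OF that(2)]] by simp
  fix f g h :: "'a \<Rightarrow> complex"
  show "0 \<le> lp_norm p (\<lambda>i. f i - g i)" by (rule lp_norm_nonneg[OF p(2)])
  show "lp_norm p (\<lambda>i. f i - g i) = lp_norm p (\<lambda>i. g i - f i)"
    using p by (simp add: lp_norm_finite norm_minus_commute)
  assume f: "f \<in> lp_space p" and g: "g \<in> lp_space p"
  show "lp_norm p (\<lambda>i. f i - g i) = 0 \<longleftrightarrow> f = g"
  proof
    assume "lp_norm p (\<lambda>i. f i - g i) = 0"
    then have "(\<Sum>\<^sub>\<infinity>i. norm (f i - g i) powr ?P) = 0"
      unfolding lp_norm_finite[OF p(2)] by (simp only: powr_eq_0_iff)
    moreover have "(\<lambda>i. norm (f i - g i) powr ?P) summable_on UNIV"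
      using diff[OF f g] unfolding lp_space_finite[OF p(2)] by (rule CollectD)
    ultimately have "norm (f i - g i) powr ?P = 0" for i
      by (intro nonneg_infsum_le_0D[of "\<lambda>i. norm (f i - g i) powr ?P" UNIV]) simp_all
    then show "f = g"
      by (simp only: powr_eq_0_iff norm_eq_zero eq_iff_diff_eq_0[symmetric]) (rule ext, simp)
  next
    assume "f = g"
    then show "lp_norm p (\<lambda>i. f i - g i) = 0" using p by (simp add: lp_norm_finite)
  qed
  assume h: "h \<in> lp_space p"
  show "lp_norm p (\<lambda>i. f i - h i) \<le> lp_norm p (\<lambda>i. f i - g i) + lp_norm p (\<lambda>i. g i - h i)"
    using lp_minkowski(2)[OF p diff[OF f g] diff[OF g h]] by simp
qed

end

theory Submission
  imports Defs
begin

text \<open>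
  Since \<open>\<langle>x + y\<rangle>\<^sup>2 \<ge> \<langle>x\<rangle>\<langle>y\<rangle>\<close> for \<open>x, y \<ge> 0\<close>, the tensor is dominated by a multiple of \<open>K(j,k) K(j,l)\<close>,
  where \<open>K(j,k) = w(j - k)\<close> and \<open>w\<close> is \<open>\<langle>\<cdot>\<rangle>\<^bsup>-N\<^esup>\<close> normalised to sum 1 (summable because \<open>N > d\<close>).
  Averaging against the bistochastic kernel \<open>K\<close> contracts every \<open>\<ell>\<^sup>p\<close>, so with Hoelder the operator
  maps \<open>\<ell>\<^sup>p \<times> \<ell>\<^sup>q\<close> to \<open>\<ell>\<^sup>r\<close>.  Split \<open>b\<close> into its restriction to the finite set
  \<open>F = {\<bar>b\<bar> \<ge> \<epsilon>}\<close> and a remainder of size at most \<open>\<epsilon>\<close>.  On the unit balls, the first part contributes at most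
  a constant times \<open>(\<Sum>k\<in>F. K(j,k)) + 1\<^sub>F(j)\<close>, a fixed sequence in \<open>\<ell>\<^sup>1 \<inter> \<ell>\<^sup>\<infinity>\<close>, and the second one a
  sequence of \<open>\<ell>\<^sup>r\<close> norm \<open>O(\<epsilon>)\<close>.  Hence the image of the unit balls is bounded with uniformly small tails,
  which characterises precompactness in \<open>\<ell>\<^sup>r\<close> for \<open>r < \<infinity>\<close>.  The second commutator is the first one for
  the tensor with \<open>k\<close> and \<open>l\<close> exchanged.
\<close>

subsection \<open>Completeness and compactness in \<open>\<ell>\<^sup>p\<close>\<close>

text \<open>A sum is at most twice the larger term, whose power is one of the two on the right. The
  constant \<open>2 powr P\<close> is crude, but later estimates absorb any fixed factor.\<close>

lemma powr_add_le_two_powr: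
  fixes x y P :: real
  assumes "0 \<le> x" "0 \<le> y" "0 \<le> P"
  shows "(x + y) powr P \<le> 2 powr P * (x powr P + y powr P)"
proof -
  have "(x + y) powr P \<le> (2 * max x y) powr P"
    using assms by (intro powr_mono2) auto
  also have "\<dots> = 2 powr P * max x y powr P"
    using assms by (simp add: powr_mult)
  also have "\<dots> \<le> 2 powr P * (x powr P + y powr P)"
    by (intro mult_left_mono) (auto simp: max_def)
  finally show ?thesis .
qed

lemma lp_norm_le_iff:
  assumes "1 \<le> p" "p < \<infinity>" "0 \<le> A"
  shows "lp_norm p f \<le> A \<longleftrightarrow> (\<Sum>\<^sub>\<infinity>i. norm (f i) powr enn2real p) \<le> A powr enn2real p"
proof -
  have P: "1 \<le> enn2real p" using enn2real_ge_1[OF assms(1,2)] .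
  have n: "0 \<le> lp_norm p f" by (rule lp_norm_nonneg[OF assms(2)])
  have "lp_norm p f \<le> A \<longleftrightarrow> lp_norm p f powr enn2real p \<le> A powr enn2real p"
    using P n assms(3)
    by (meson linorder_not_less order_trans powr_less_mono2 powr_mono2 zero_le_one zero_less_one
        less_le_trans)
  then show ?thesis by (simp add: lp_norm_powr[OF assms(1,2)])
qed

text \<open>A single term is a partial sum of a nonnegative series. Every \<open>lp_space p\<close>
  thus consists of bounded sequences, which is all that convergence of the tensor sums relies
  on.\<close>

lemma lp_norm_ge_coord:
  assumes "1 \<le> p" "f \<in> lp_space p"
  shows "norm (f i) \<le> lp_norm p f"
proof (cases "p = \<infinity>")
  case True
  then show ?thesis using assms(2) by (auto simp: lp_space_def lp_norm_def intro: cSUP_upper)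
next
  case False
  then have p: "p < \<infinity>" by (simp add: top.not_eq_extremum)
  let ?P = "enn2real p"
  have P: "1 \<le> ?P" using enn2real_ge_1[OF assms(1) p] .
  have "norm (f i) powr ?P \<le> (\<Sum>\<^sub>\<infinity>i. norm (f i) powr ?P)"
    using finite_sum_le_infsum[of "\<lambda>i. norm (f i) powr ?P" UNIV "{i}"] assms(2) p
    by (simp add: lp_space_finite)
  then have "norm (f i) powr ?P \<le> lp_norm p f powr ?P"
    by (simp add: lp_norm_powr[OF assms(1) p])
  then show ?thesis
    using P lp_norm_nonneg[OF p, of f] powr_less_mono2[of ?P "lp_norm p f" "norm (f i)"] by force
qed

lemma lp_space_diff:
  assumes "1 \<le> p" "p < \<infinity>" "f \<in> lp_space p" "g \<in> lp_space p"
  shows "(\<lambda>i. f i - g i) \<in> lp_space p"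
proof -
  have "(\<lambda>i. - g i) \<in> lp_space p"
    using assms by (simp add: lp_space_finite)
  from lp_minkowski(1)[OF assms(1,2,3) this] show ?thesis by simp
qed

text \<open>Coordinates of a Cauchy sequence converge in the complex numbers. Norm bounds survive
  the limit because they are equivalent to bounds on all finite partial sums.\<close>

lemma mcomplete_lp:
  assumes p: "1 \<le> p" "p < \<infinity>"
  shows "Metric_space.mcomplete (lp_space p) (\<lambda>f g. lp_norm p (\<lambda>i. f i - g i))"
proof -
  interpret Metric_space "lp_space p" "\<lambda>f g. lp_norm p (\<lambda>i. f i - g i)"
    by (rule Metric_space_lp[OF p])
  let ?P = "enn2real p"
  have P: "1 \<le> ?P" using enn2real_ge_1[OF p] .
  have "\<exists>h. limitin mtopology \<sigma> h sequentially" if "MCauchy \<sigma>" for \<sigma> :: "nat \<Rightarrow> 'a \<Rightarrow> complex"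
  proof -
    have \<sigma>: "\<sigma> n \<in> lp_space p" for n using that by (auto simp: MCauchy_def)
    have cau: "\<exists>N. \<forall>n\<ge>N. \<forall>m\<ge>N. lp_norm p (\<lambda>i. \<sigma> n i - \<sigma> m i) < e" if "0 < e" for e
      using \<open>MCauchy \<sigma>\<close> that unfolding MCauchy_def by meson
    have "\<exists>l. (\<lambda>n. \<sigma> n i) \<longlonglongrightarrow> l" for i
    proof -
      have "Cauchy (\<lambda>n. \<sigma> n i)"
      proof (rule metric_CauchyI)
        fix e :: real assume "0 < e"
        then obtain N where N: "\<forall>n\<ge>N. \<forall>m\<ge>N. lp_norm p (\<lambda>i. \<sigma> n i - \<sigma> m i) < e"
          using cau by blast
        have "dist (\<sigma> m i) (\<sigma> n i) < e" if "m \<ge> N" "n \<ge> N" for m n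
        proof -
          have "norm (\<sigma> m i - \<sigma> n i) \<le> lp_norm p (\<lambda>i. \<sigma> m i - \<sigma> n i)"
            using lp_norm_ge_coord[OF p(1) lp_space_diff[OF p \<sigma>[of m] \<sigma>[of n]], of i] .
          then show ?thesis using N that by (fastforce simp: dist_norm)
        qed
        then show "\<exists>M. \<forall>m\<ge>M. \<forall>n\<ge>M. dist (\<sigma> m i) (\<sigma> n i) < e" by blast
      qed
      then show ?thesis by (simp add: Cauchy_convergent_iff convergent_def)
    qed
    then obtain h where h: "\<And>i. (\<lambda>n. \<sigma> n i) \<longlonglongrightarrow> h i" by metis
    have close: "(\<lambda>i. \<sigma> n i - h i) \<in> lp_space p \<and> lp_norm p (\<lambda>i. \<sigma> n i - h i) \<le> e"
      if e: "0 < e" and N: "\<forall>n\<ge>N. \<forall>m\<ge>N. lp_norm p (\<lambda>i. \<sigma> n i - \<sigma> m i) < e" and n: "n \<ge> N"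
      for e N n
    proof -
      \<comment> \<open>Fix \<open>n\<close> and let \<open>m\<close> tend to infinity inside a
        finite sum. The powers pass to the limit even at base 0, since the exponent is
        positive.\<close>
      have fin: "(\<Sum>i\<in>F. norm (\<sigma> n i - h i) powr ?P) \<le> e powr ?P" if F: "finite F" for F
      proof (rule LIMSEQ_le_const2)
        show "(\<lambda>m. \<Sum>i\<in>F. norm (\<sigma> n i - \<sigma> m i) powr ?P) \<longlonglongrightarrow> (\<Sum>i\<in>F. norm (\<sigma> n i - h i) powr ?P)"
          using P by (intro tendsto_sum tendsto_powr' tendsto_norm tendsto_diff h tendsto_const) auto
        have "(\<Sum>i\<in>F. norm (\<sigma> n i - \<sigma> m i) powr ?P) \<le> e powr ?P" if "m \<ge> N" for m
        proof -
          have s: "(\<lambda>i. norm (\<sigma> n i - \<sigma> m i) powr ?P) summable_on UNIV"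
            using lp_space_diff[OF p \<sigma>[of n] \<sigma>[of m]] p by (simp add: lp_space_finite)
          have "(\<Sum>i\<in>F. norm (\<sigma> n i - \<sigma> m i) powr ?P) \<le> (\<Sum>\<^sub>\<infinity>i. norm (\<sigma> n i - \<sigma> m i) powr ?P)"
            by (rule finite_sum_le_infsum[OF s F]) auto
          also have "\<dots> \<le> e powr ?P"
            using lp_norm_le_iff[OF p, of e "\<lambda>i. \<sigma> n i - \<sigma> m i"] N n that e less_imp_le by blast
          finally show ?thesis .
        qed
        then show "\<exists>M. \<forall>m\<ge>M. (\<Sum>i\<in>F. norm (\<sigma> n i - \<sigma> m i) powr ?P) \<le> e powr ?P" by blast
      qed
      have s: "(\<lambda>i. norm (\<sigma> n i - h i) powr ?P) summable_on UNIV"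
        by (rule nonneg_bdd_above_summable_on) (auto intro!: bdd_aboveI2 fin)
      have "(\<Sum>\<^sub>\<infinity>i. norm (\<sigma> n i - h i) powr ?P) \<le> e powr ?P"
        by (rule infsum_le_finite_sums[OF s fin])
      then show ?thesis
        using s e p lp_norm_le_iff[OF p, of e "\<lambda>i. \<sigma> n i - h i"] by (simp add: lp_space_finite)
    qed
    have "h \<in> lp_space p"
    proof -
      obtain N where "\<forall>n\<ge>N. \<forall>m\<ge>N. lp_norm p (\<lambda>i. \<sigma> n i - \<sigma> m i) < 1"
        using cau[of 1] by auto
      then have "(\<lambda>i. \<sigma> N i - h i) \<in> lp_space p" using close[of 1 N N] by simp
      from lp_space_diff[OF p \<sigma>[of N] this] show ?thesis by simp
    qed
    moreover have "\<exists>N. \<forall>n\<ge>N. \<sigma> n \<in> lp_space p \<and> lp_norm p (\<lambda>i. \<sigma> n i - h i) < e" if "0 < e" for e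
    proof -
      \<comment> \<open>Half of \<open>e\<close> is used because \<open>close\<close> yields a
        non-strict bound and a strict one is wanted.\<close>
      obtain N where N: "\<forall>n\<ge>N. \<forall>m\<ge>N. lp_norm p (\<lambda>i. \<sigma> n i - \<sigma> m i) < e/2"
        using cau[OF half_gt_zero[OF \<open>0 < e\<close>]] by blast
      have "\<sigma> n \<in> lp_space p \<and> lp_norm p (\<lambda>i. \<sigma> n i - h i) < e" if "n \<ge> N" for n
        using close[OF _ N that] \<open>0 < e\<close> \<sigma>[of n] by force
      then show ?thesis by blast
    qed
    ultimately show ?thesis by (auto simp: limit_metric_sequentially)
  qed
  then show ?thesis by (auto simp: mcomplete_def)
qed

text \<open>This is the Frechet-Kolmogorov criterion for sequences. Up to small tails only finitely
  many coordinates matter, and these range over a disc, which is totally bounded; completeness turns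
  total boundedness into compactness of the closure.\<close>

lemma compactin_lp_closure:
  fixes S :: "('i \<Rightarrow> complex) set"
  assumes p: "1 \<le> p" "p < \<infinity>" and S: "S \<subseteq> lp_space p"
    and bnd: "\<And>h i. h \<in> S \<Longrightarrow> norm (h i) \<le> R"
    and tails: "\<And>e. 0 < e \<Longrightarrow> \<exists>F. finite F \<and> (\<forall>h\<in>S. (\<Sum>\<^sub>\<infinity>i\<in>-F. norm (h i) powr enn2real p) \<le> e)"
  shows "compactin (norm_topology (lp_space p) (lp_norm p))
           (norm_topology (lp_space p) (lp_norm p) closure_of S)"
proof -
  interpret Metric_space "lp_space p" "\<lambda>f g. lp_norm p (\<lambda>i. f i - g i)"
    by (rule Metric_space_lp[OF p])
  let ?P = "enn2real p"
  have P: "1 \<le> ?P" using enn2real_ge_1[OF p] .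
  have "mtotally_bounded S" unfolding mtotally_bounded_def
  proof (intro allI impI)
    fix e :: real assume e: "0 < e"
    \<comment> \<open>Two tails of size \<eta> cost \<open>2 powr P * (\<eta> + \<eta>)\<close>,
      which this choice makes half of the budget \<open>(e/2) powr P\<close>.\<close>
    define \<eta> where "\<eta> = (e/2) powr ?P / (2 * (2 * 2 powr ?P))"
    have "0 < \<eta>" using e by (simp add: \<eta>_def)
    then obtain F where F: "finite F" "\<And>h. h \<in> S \<Longrightarrow> (\<Sum>\<^sub>\<infinity>i\<in>-F. norm (h i) powr ?P) \<le> \<eta>"
      using tails by metis
    \<comment> \<open>The other half of the budget is shared among the coordinates in
      \<open>F\<close>; the \<open>+ 1\<close> keeps the denominator positive when \<open>F\<close>
      is empty.\<close>
    define t where "t = (e/2) powr ?P / (2 * (real (card F) + 1))"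
    have t: "0 < t" using e by (simp add: t_def)
    \<comment> \<open>Two values close to the same net point differ by at most
      \<open>2 * \<delta>\<close>, whose \<open>P\<close>-th power is \<open>t\<close>.\<close>
    define \<delta> where "\<delta> = t powr (1 / ?P) / 2"
    have \<delta>: "0 < \<delta>" "(2 * \<delta>) powr ?P = t" using t P by (auto simp: \<delta>_def powr_powr)
    have "compact (cball (0::complex) R)" by simp
    then obtain D where D: "finite D" "cball (0::complex) R \<subseteq> (\<Union>z\<in>D. ball z \<delta>)"
      using \<delta>(1) by (auto simp: compact_eq_totally_bounded)
    have "\<exists>z\<in>D. dist (h i) z < \<delta>" if "h \<in> S" for h i
      using D(2) bnd[OF that, of i] by (force simp: dist_commute)
    then obtain n where n: "\<And>h i. h \<in> S \<Longrightarrow> n h i \<in> D \<and> dist (h i) (n h i) < \<delta>" by metis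
    \<comment> \<open>The code of \<open>h\<close> lists the net points chosen on \<open>F\<close>.
      Restriction makes it undefined elsewhere, so only finitely many codes exist; members of
      \<open>S\<close> with equal codes will be \<open>e\<close>-close.\<close>
    define c where "c h = restrict (n h) F" for h
    have "c ` S \<subseteq> PiE F (\<lambda>_. D)" using n by (auto simp: c_def)
    then have fin: "finite (c ` S)"
      using F(1) D(1) by (meson finite_PiE finite_subset)
    have close: "lp_norm p (\<lambda>i. h i - h' i) < e" if h: "h \<in> S" "h' \<in> S" and eq: "c h = c h'" for h h'
    proof -
      have mem: "h \<in> lp_space p" "h' \<in> lp_space p" using h S by auto
      have s: "(\<lambda>i. norm (h i - h' i) powr ?P) summable_on A"
        "(\<lambda>i. norm (h i) powr ?P) summable_on A" "(\<lambda>i. norm (h' i) powr ?P) summable_on A" for A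
        using lp_space_diff[OF p mem] mem p
        by (auto simp: lp_space_finite intro: summable_on_subset[of _ UNIV])
      have "norm (h i - h' i) powr ?P \<le> t" if "i \<in> F" for i
      proof -
        have "n h i = n h' i" using eq that unfolding c_def by (metis restrict_apply')
        then have "norm (h i - h' i) \<le> 2 * \<delta>"
          using n[OF h(1), of i] n[OF h(2), of i] dist_triangle_half_l[of "h i" "n h i" "2*\<delta>" "h' i"]
          by (simp add: dist_norm)
        then show ?thesis using P \<delta> by (metis norm_ge_zero powr_mono2 order_trans zero_le_one)
      qed
      then have "(\<Sum>i\<in>F. norm (h i - h' i) powr ?P) \<le> real (card F) * t"
        by (rule sum_bounded_above)
      also have "\<dots> \<le> (e/2) powr ?P / 2"
        using e by (simp add: t_def field_simps)
      finally have 1: "(\<Sum>i\<in>F. norm (h i - h' i) powr ?P) \<le> (e/2) powr ?P / 2" .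
      have "(\<Sum>\<^sub>\<infinity>i\<in>-F. norm (h i - h' i) powr ?P)
          \<le> (\<Sum>\<^sub>\<infinity>i\<in>-F. 2 powr ?P * (norm (h i) powr ?P + norm (h' i) powr ?P))"
      proof (rule infsum_mono[OF s(1)])
        show "(\<lambda>i. 2 powr ?P * (norm (h i) powr ?P + norm (h' i) powr ?P)) summable_on - F"
          by (intro summable_on_cmult_right summable_on_add s)
        fix i
        have "norm (h i - h' i) powr ?P \<le> (norm (h i) + norm (h' i)) powr ?P"
          using P by (intro powr_mono2 norm_triangle_ineq4) auto
        also have "\<dots> \<le> 2 powr ?P * (norm (h i) powr ?P + norm (h' i) powr ?P)"
          using P by (intro powr_add_le_two_powr) auto
        finally show "norm (h i - h' i) powr ?P \<le> 2 powr ?P * (norm (h i) powr ?P + norm (h' i) powr ?P)" .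
      qed
      also have "\<dots> = 2 powr ?P * ((\<Sum>\<^sub>\<infinity>i\<in>-F. norm (h i) powr ?P) + (\<Sum>\<^sub>\<infinity>i\<in>-F. norm (h' i) powr ?P))"
        by (subst infsum_cmult_right) (auto intro!: summable_on_add s infsum_add)
      also have "\<dots> \<le> 2 powr ?P * (\<eta> + \<eta>)"
        using F(2) h by (intro mult_left_mono add_mono) auto
      also have "\<dots> = (e/2) powr ?P / 2" by (simp add: \<eta>_def)
      finally have 2: "(\<Sum>\<^sub>\<infinity>i\<in>-F. norm (h i - h' i) powr ?P) \<le> (e/2) powr ?P / 2" .
      have "(\<Sum>\<^sub>\<infinity>i. norm (h i - h' i) powr ?P)
          = (\<Sum>\<^sub>\<infinity>i\<in>F. norm (h i - h' i) powr ?P) + (\<Sum>\<^sub>\<infinity>i\<in>-F. norm (h i - h' i) powr ?P)"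
        using infsum_Un_disjoint[OF s(1) s(1), of F "- F"] by simp
      also have "\<dots> \<le> (e/2) powr ?P" using 1 2 F(1) by simp
      finally have "lp_norm p (\<lambda>i. h i - h' i) \<le> e / 2"
        using lp_norm_le_iff[OF p, of "e/2" "\<lambda>i. h i - h' i"] e by simp
      then show ?thesis using e by simp
    qed
    \<comment> \<open>One representative in \<open>S\<close> per code forms the finite net.\<close>
    show "\<exists>K. finite K \<and> K \<subseteq> S \<and> S \<subseteq> (\<Union>x\<in>K. mball x e)"
    proof (intro exI conjI)
      show "finite (inv_into S c ` c ` S)" using fin by simp
      show "inv_into S c ` c ` S \<subseteq> S" by (auto intro: inv_into_into)
      show "S \<subseteq> (\<Union>x\<in>inv_into S c ` c ` S. mball x e)"
      proof
        fix h assume h: "h \<in> S"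
        let ?k = "inv_into S c (c h)"
        have k: "?k \<in> S" "c ?k = c h" using h by (simp_all add: inv_into_into f_inv_into_f)
        then have "h \<in> mball ?k e" using close[OF k(1) h k(2)] S h by auto
        then show "h \<in> (\<Union>x\<in>inv_into S c ` c ` S. mball x e)" using h by blast
      qed
    qed
  qed
  then show ?thesis
    unfolding norm_topology_def using mtotally_bounded_eq_compact_closure_of[OF mcomplete_lp[OF p]] by blast
qed

subsection \<open>Hoelder's inequality\<close>

text \<open>The exponent relation is multiplied by \<open>r\<close> and moved to the reals, giving
  the two convex weights for Young's inequality.\<close>

lemma enn2real_inverse_add:
  assumes "1 \<le> p" "1 \<le> q" "p < \<infinity>" "q < \<infinity>" "1 \<le> r" "r < (\<infinity>::ennreal)" "1 / p + 1 / q = 1 / r"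
  shows "enn2real r / enn2real p + enn2real r / enn2real q = 1"
proof -
  have pos: "1 \<le> enn2real p" "1 \<le> enn2real q" "1 \<le> enn2real r"
    using assms by (auto intro: enn2real_ge_1)
  have "1 / ennreal (enn2real p) + 1 / ennreal (enn2real q) = 1 / ennreal (enn2real r)"
    using assms by simp
  then have "ennreal (1 / enn2real p + 1 / enn2real q) = ennreal (1 / enn2real r)"
    using pos by (simp add: divide_ennreal flip: ennreal_1 ennreal_plus)
  then have "1 / enn2real p + 1 / enn2real q = 1 / enn2real r"
    using pos by (subst (asm) ennreal_inj) auto
  moreover have "enn2real r / enn2real p + enn2real r / enn2real q
      = enn2real r * (1 / enn2real p + 1 / enn2real q)"
    by (simp add: distrib_left)
  ultimately show ?thesis using pos by simp
qed

text \<open>A convex function lies above its tangent at \<open>a\<close>. The proof is Young's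
  inequality for \<open>x powr P\<close> and \<open>a powr P\<close> with weights \<open>1/P\<close>
  and \<open>1 - 1/P\<close>.\<close>

lemma powr_tangent_le:
  fixes a x P :: real
  assumes "1 \<le> P" "0 \<le> a" "0 \<le> x"
  shows "a powr P + P * a powr (P - 1) * (x - a) \<le> x powr P"
\<comment> \<open>Young's inequality is applied to positive numbers only. At \<open>a = 0\<close>
  the slope term vanishes even for \<open>P = 1\<close>, since \<open>0 powr 0 = 0\<close>.\<close>
proof (cases "a = 0 \<or> x = 0 \<or> P = 1")
  case True
  moreover have "a powr P \<le> P * a powr (P - 1) * a" if "a \<noteq> 0"
  proof -
    have "a powr P = a powr (P - 1) * a" using that assms by (simp add: powr_diff)
    moreover have "1 * (a powr (P - 1) * a) \<le> P * (a powr (P - 1) * a)"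
      using assms by (intro mult_right_mono) auto
    ultimately show ?thesis by (simp add: mult.assoc)
  qed
  ultimately show ?thesis using assms by (cases "a = 0") (auto simp: algebra_simps)
next
  case False
  then have a: "0 < a" "0 < x" "1 < P" using assms by auto
  have "(x powr P) powr (1/P) * (a powr P) powr (1 - 1/P) \<le> 1/P * x powr P + (1 - 1/P) * a powr P"
    using a by (intro Youngs_inequality_0) auto
  moreover have "(x powr P) powr (1/P) = x" "(a powr P) powr (1 - 1/P) = a powr (P - 1)"
    using a by (auto simp: powr_powr right_diff_distrib)
  ultimately have "P * (x * a powr (P - 1)) \<le> P * (1/P * x powr P + (1 - 1/P) * a powr P)"
    using a by simp
  also have "\<dots> = x powr P + (P - 1) * a powr P" using a by (simp add: field_simps)
  finally have "P * (x * a powr (P - 1)) \<le> x powr P + (P - 1) * a powr P" .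
  moreover have "a powr P = a powr (P - 1) * a" using a by (simp add: powr_diff)
  ultimately show ?thesis by (simp add: algebra_simps)
qed

lemma lp_space_bounded:
  assumes "1 \<le> p" "f \<in> lp_space p"
  obtains R where "0 \<le> R" "\<And>i. norm (f i) \<le> R"
  using lp_norm_ge_coord[OF assms] norm_ge_zero order_trans by metis

lemma lp_space_dominated:
  assumes "1 \<le> p" "g \<in> lp_space p" "\<And>i. norm (f i) \<le> c * norm (g i)" "0 \<le> c"
  shows "f \<in> lp_space p"
proof (cases "p = \<infinity>")
  case True
  obtain R where "0 \<le> R" "\<And>i. norm (g i) \<le> R" using lp_space_bounded[OF assms(1,2)] by blast
  then have "norm (f i) \<le> c * R" for i
    using assms(3)[of i] mult_left_mono[OF _ assms(4)] order_trans by blast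
  then show ?thesis using True by (auto simp: lp_space_def intro: bdd_aboveI2[of _ _ "c * R"])
next
  case False
  then have p: "p < \<infinity>" by (simp add: top.not_eq_extremum)
  let ?P = "enn2real p"
  have P: "1 \<le> ?P" using enn2real_ge_1[OF assms(1) p] .
  have "norm (f i) powr ?P \<le> c powr ?P * norm (g i) powr ?P" for i
  proof -
    have "norm (f i) powr ?P \<le> (c * norm (g i)) powr ?P"
      using P assms(3) by (intro powr_mono2) auto
    then show ?thesis using assms(4) by (simp add: powr_mult)
  qed
  moreover have "(\<lambda>i. c powr ?P * norm (g i) powr ?P) summable_on UNIV"
    using assms(2) p by (intro summable_on_cmult_right) (simp add: lp_space_finite)
  ultimately show ?thesis using p
    by (auto simp: lp_space_finite intro: summable_on_comparison_test)
qed

text \<open>For finite exponents, Young's inequality holds at each index and is summed; on the unit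
  balls the weights add up to the bound 1. If one exponent is infinite, the other equals
  \<open>r\<close> and the bounded factor is estimated pointwise.\<close>

lemma lp_mult:
  assumes pqr: "1 \<le> p" "1 \<le> q" "1 \<le> r" "r < \<infinity>" "1 / p + 1 / q = 1 / r"
    and f: "f \<in> lp_space p" and g: "g \<in> lp_space q"
  shows "(\<lambda>i. f i * g i) \<in> lp_space r"
    and "lp_norm p f \<le> 1 \<Longrightarrow> lp_norm q g \<le> 1 \<Longrightarrow> lp_norm r (\<lambda>i. f i * g i) \<le> 1"
proof -
  \<comment> \<open>Stated for a bounded factor \<open>u\<close>, so that it serves for
    \<open>p = \<infinity>\<close> and, after commuting the product, for
    \<open>q = \<infinity>\<close>.\<close>
  have infty: "(\<lambda>i. u i * v i) \<in> lp_space r \<and>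
      (lp_norm \<infinity> u \<le> 1 \<longrightarrow> lp_norm r v \<le> 1 \<longrightarrow> lp_norm r (\<lambda>i. u i * v i) \<le> 1)"
    if u: "u \<in> lp_space \<infinity>" and v: "v \<in> lp_space r" for u v :: "'a \<Rightarrow> complex"
  proof
    obtain R where R: "0 \<le> R" "\<And>i. norm (u i) \<le> R" by (rule lp_space_bounded[OF _ u]) auto
    show uv: "(\<lambda>i. u i * v i) \<in> lp_space r"
      by (rule lp_space_dominated[OF pqr(3) v _ R(1)]) (simp add: norm_mult mult_right_mono R(2))
    show "lp_norm \<infinity> u \<le> 1 \<longrightarrow> lp_norm r v \<le> 1 \<longrightarrow> lp_norm r (\<lambda>i. u i * v i) \<le> 1"
    proof (intro impI)
      assume 1: "lp_norm \<infinity> u \<le> 1" "lp_norm r v \<le> 1"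
      have "norm (u i) \<le> 1" for i using lp_norm_ge_coord[OF _ u, of i] 1(1) by simp
      then have "norm (u i * v i) powr enn2real r \<le> norm (v i) powr enn2real r" for i
        using enn2real_ge_1[OF pqr(3,4)] by (intro powr_mono2) (auto simp: norm_mult mult_left_le_one_le)
      then have "(\<Sum>\<^sub>\<infinity>i. norm (u i * v i) powr enn2real r) \<le> (\<Sum>\<^sub>\<infinity>i. norm (v i) powr enn2real r)"
        using uv v pqr(4) by (intro infsum_mono) (auto simp: lp_space_finite)
      then show "lp_norm r (\<lambda>i. u i * v i) \<le> 1"
        using 1(2) lp_norm_le_iff[OF pqr(3,4), of 1 v] lp_norm_le_iff[OF pqr(3,4), of 1 "\<lambda>i. u i * v i"]
        by simp
    qed
  qed
  \<comment> \<open>Reciprocals determine the exponent. The value \<open>s = \<infinity>\<close>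
    would give \<open>1 / r = 0\<close>, impossible for finite \<open>r\<close>.\<close>
  have eq: "s = r" if "1 / s = 1 / r" "1 \<le> s" for s :: ennreal
  proof (cases "s = \<infinity>")
    case True
    then have "1 / r = 0" using that(1) by simp
    then show ?thesis using pqr(4) by (simp add: divide_ennreal_def)
  next
    case False
    then have s: "s < \<infinity>" by (simp add: top.not_eq_extremum)
    then have ge: "1 \<le> enn2real s" "1 \<le> enn2real r"
      using that(2) pqr by (auto intro: enn2real_ge_1)
    have "1 / ennreal (enn2real s) = 1 / ennreal (enn2real r)" using that(1) s pqr(4) by simp
    then have "ennreal (1 / enn2real s) = ennreal (1 / enn2real r)"
      using ge by (simp add: divide_ennreal flip: ennreal_1)
    then have "enn2real s = enn2real r" using ge by (subst (asm) ennreal_inj) auto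
    then show ?thesis using s pqr(4) by (metis ennreal_enn2real infinity_ennreal_def)
  qed
  have *: "(\<lambda>i. f i * g i) \<in> lp_space r \<and>
      (lp_norm p f \<le> 1 \<longrightarrow> lp_norm q g \<le> 1 \<longrightarrow> lp_norm r (\<lambda>i. f i * g i) \<le> 1)"
  proof (cases "p = \<infinity> \<or> q = \<infinity>")
    case True
    then show ?thesis
    proof
      assume "p = \<infinity>"
      then show ?thesis using infty[of f g] f g eq[of q] pqr(2,5) by simp
    next
      assume "q = \<infinity>"
      then show ?thesis using infty[of g f] f g eq[of p] pqr(1,5) by (simp add: mult.commute)
    qed
  next
    case False
    then have p: "p < \<infinity>" "q < \<infinity>" by (auto simp: top.not_eq_extremum)
    define P Q R where "P = enn2real p" and "Q = enn2real q" and "R = enn2real r"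
    have ge: "1 \<le> P" "1 \<le> Q" "1 \<le> R"
      using pqr p by (auto simp: P_def Q_def R_def intro: enn2real_ge_1)
    have sum1: "R / P + R / Q = 1"
      unfolding P_def Q_def R_def by (rule enn2real_inverse_add) (use pqr p in auto)
    have sf: "(\<lambda>i. norm (f i) powr P) summable_on UNIV" and sg: "(\<lambda>i. norm (g i) powr Q) summable_on UNIV"
      using f g p by (auto simp: lp_space_finite P_def Q_def)
    have young: "norm (f i * g i) powr R \<le> R / P * norm (f i) powr P + R / Q * norm (g i) powr Q" for i
    proof (cases "f i = 0 \<or> g i = 0")
      case True
      then show ?thesis using ge by auto
    next
      case False
      then have "(norm (f i) powr P) powr (R / P) * (norm (g i) powr Q) powr (R / Q)
          \<le> R / P * norm (f i) powr P + R / Q * norm (g i) powr Q"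
        using ge sum1 by (intro Youngs_inequality_0) auto
      then show ?thesis using ge by (simp add: powr_powr norm_mult powr_mult)
    qed
    have s: "(\<lambda>i. R / P * norm (f i) powr P + R / Q * norm (g i) powr Q) summable_on UNIV"
      by (intro summable_on_add summable_on_cmult_right sf sg)
    have sfg: "(\<lambda>i. norm (f i * g i) powr R) summable_on UNIV"
      by (rule summable_on_comparison_test[OF s]) (use young in auto)
    have "lp_norm r (\<lambda>i. f i * g i) \<le> 1" if "lp_norm p f \<le> 1" "lp_norm q g \<le> 1"
    proof -
      have "(\<Sum>\<^sub>\<infinity>i. norm (f i * g i) powr R)
          \<le> (\<Sum>\<^sub>\<infinity>i. R / P * norm (f i) powr P + R / Q * norm (g i) powr Q)"
        by (rule infsum_mono[OF sfg s young])
      also have "\<dots> = R / P * (\<Sum>\<^sub>\<infinity>i. norm (f i) powr P) + R / Q * (\<Sum>\<^sub>\<infinity>i. norm (g i) powr Q)"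
        by (simp only: infsum_add summable_on_cmult_right sf sg infsum_cmult_right')
      also have "\<dots> \<le> R / P * 1 + R / Q * 1"
        using that ge lp_norm_le_iff[OF pqr(1) p(1), of 1 f] lp_norm_le_iff[OF pqr(2) p(2), of 1 g]
        by (intro add_mono mult_left_mono) (auto simp: P_def Q_def)
      finally show ?thesis
        using sum1 lp_norm_le_iff[OF pqr(3,4), of 1 "\<lambda>i. f i * g i"] by (simp add: R_def)
    qed
    then show ?thesis using sfg pqr(4) by (simp add: lp_space_finite R_def)
  qed
  show "(\<lambda>i. f i * g i) \<in> lp_space r" using * by simp
  show "lp_norm p f \<le> 1 \<Longrightarrow> lp_norm q g \<le> 1 \<Longrightarrow> lp_norm r (\<lambda>i. f i * g i) \<le> 1" using * by simp
qed

subsection \<open>Averaging against a bistochastic kernel\<close>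

text \<open>Unit row sums make each row a probability weight, as Jensen's inequality requires; unit
  column sums preserve totals once the order of summation is exchanged.\<close>

definition bistochastic :: "('i \<Rightarrow> 'i \<Rightarrow> real) \<Rightarrow> bool" where
  "bistochastic K \<longleftrightarrow> (\<forall>j k. 0 \<le> K j k) \<and> (\<forall>j. (K j has_sum 1) UNIV) \<and>
     (\<forall>k. ((\<lambda>j. K j k) has_sum 1) UNIV)"

definition kernel_avg :: "('i \<Rightarrow> 'i \<Rightarrow> real) \<Rightarrow> ('i \<Rightarrow> complex) \<Rightarrow> 'i \<Rightarrow> real" where
  "kernel_avg K f j = (\<Sum>\<^sub>\<infinity>k. K j k * norm (f k))"

context
  fixes K :: "'i \<Rightarrow> 'i \<Rightarrow> real"
  assumes K: "bistochastic K"
begin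

lemma kernel_nonneg: "0 \<le> K j k"
  and kernel_row: "K j summable_on UNIV" "(\<Sum>\<^sub>\<infinity>k. K j k) = 1"
  and kernel_column: "(\<lambda>j. K j k) summable_on UNIV" "(\<Sum>\<^sub>\<infinity>j. K j k) = 1"
  using K by (auto simp: bistochastic_def has_sum_iff)

lemma kernel_le_1: "K j k \<le> 1"
  using finite_sum_le_infsum[OF kernel_row(1), of "{k}" j] kernel_nonneg kernel_row(2) by simp

lemma kernel_mult_summable:
  assumes "\<And>k. norm (x k) \<le> (R::real)"
  shows "(\<lambda>k. K j k * x k) summable_on UNIV"
proof -
  have "(\<lambda>k. norm (K j k * x k)) summable_on UNIV"
  proof (rule Infinite_Sum.abs_summable_on_comparison_test')
    show "(\<lambda>k. K j k * R) summable_on UNIV"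
      by (intro summable_on_cmult_left kernel_row)
    show "norm (K j k * x k) \<le> K j k * R" for k
      using assms[of k] kernel_nonneg[of j k] by (simp add: abs_mult mult_left_mono)
  qed
  then show ?thesis by (rule abs_summable_summable)
qed

lemma kernel_avg_nonneg: "0 \<le> kernel_avg K f j"
  by (auto simp: kernel_avg_def intro!: infsum_nonneg mult_nonneg_nonneg kernel_nonneg)

lemma kernel_avg_le:
  assumes "\<And>k. norm (f k) \<le> R"
  shows "kernel_avg K f j \<le> R"
proof -
  have "kernel_avg K f j \<le> (\<Sum>\<^sub>\<infinity>k. K j k * R)"
    unfolding kernel_avg_def using assms
    by (intro infsum_mono kernel_mult_summable[of _ R] summable_on_cmult_left kernel_row)
      (auto intro: mult_left_mono kernel_nonneg)
  also have "\<dots> = R" by (subst infsum_cmult_left) (auto intro: kernel_row simp: kernel_row)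
  finally show ?thesis .
qed

text \<open>Jensen's inequality: the tangent inequality at the average \<open>a\<close> is
  integrated against row \<open>j\<close>, and the linear term cancels.\<close>

lemma kernel_avg_powr_le:
  assumes P: "1 \<le> P" and f: "\<And>k. norm (f k) \<le> R"
  shows "kernel_avg K f j powr P \<le> (\<Sum>\<^sub>\<infinity>k. K j k * norm (f k) powr P)"
proof -
  define a where "a = kernel_avg K f j"
  have a: "0 \<le> a" unfolding a_def by (rule kernel_avg_nonneg)
  have s1: "(\<lambda>k. K j k * norm (f k)) summable_on UNIV"
    using f by (intro kernel_mult_summable[of _ R]) auto
  have s2: "(\<lambda>k. K j k * norm (f k) powr P) summable_on UNIV"
    using f P by (intro kernel_mult_summable[of _ "R powr P"]) (auto intro: powr_mono2)
  define c where "c = P * a powr (P - 1)"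
  \<comment> \<open>The tangent line splits into a constant, averaged with total weight 1, and a
    multiple of \<open>norm (f k)\<close>, whose average is \<open>a\<close>. The sum is
    \<open>a powr P\<close>.\<close>
  have "((\<lambda>k. K j k * (a powr P - c * a) + c * (K j k * norm (f k))) has_sum (1 * (a powr P - c * a) + c * a)) UNIV"
    using s1 kernel_row by (intro has_sum_add has_sum_cmult_left has_sum_cmult_right)
      (auto simp: has_sum_iff a_def kernel_avg_def)
  then have "((\<lambda>k. K j k * (a powr P - c * a) + c * (K j k * norm (f k))) has_sum (a powr P)) UNIV"
    by simp
  moreover have "((\<lambda>k. K j k * norm (f k) powr P) has_sum (\<Sum>\<^sub>\<infinity>k. K j k * norm (f k) powr P)) UNIV"
    using s2 by simp
  ultimately have "a powr P \<le> (\<Sum>\<^sub>\<infinity>k. K j k * norm (f k) powr P)"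
  proof (rule has_sum_mono)
    fix k
    have "K j k * (a powr P + c * (norm (f k) - a)) \<le> K j k * norm (f k) powr P"
      unfolding c_def by (intro mult_left_mono powr_tangent_le P a kernel_nonneg) auto
    then show "K j k * (a powr P - c * a) + c * (K j k * norm (f k)) \<le> K j k * norm (f k) powr P"
      by (simp add: algebra_simps)
  qed
  then show ?thesis by (simp add: a_def)
qed

text \<open>For finite \<open>p\<close>, Jensen in each row followed by summation over
  \<open>j\<close> leaves the column sums, which are 1. For \<open>p = \<infinity>\<close> an
  average stays below the supremum.\<close>

lemma kernel_avg_lp:
  assumes p: "1 \<le> p" and f: "f \<in> lp_space p"
  shows "(\<lambda>j. complex_of_real (kernel_avg K f j)) \<in> lp_space p"
    and "lp_norm p (\<lambda>j. complex_of_real (kernel_avg K f j)) \<le> lp_norm p f"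
proof -
  let ?h = "\<lambda>j. complex_of_real (kernel_avg K f j)"
  have n: "norm (?h j) = kernel_avg K f j" for j using kernel_avg_nonneg by simp
  have "?h \<in> lp_space p \<and> lp_norm p ?h \<le> lp_norm p f"
  proof (cases "p = \<infinity>")
    case True
    have "kernel_avg K f j \<le> lp_norm p f" for j
      by (rule kernel_avg_le[OF lp_norm_ge_coord[OF p f]])
    then show ?thesis unfolding True
      by (auto simp: lp_space_def lp_norm_def n intro!: bdd_aboveI2 cSUP_least simp del: norm_of_real)
  next
    case False
    then have fin: "p < \<infinity>" by (simp add: top.not_eq_extremum)
    let ?P = "enn2real p"
    have P: "1 \<le> ?P" using enn2real_ge_1[OF p fin] .
    have sf: "(\<lambda>k. norm (f k) powr ?P) summable_on UNIV"
      using f fin by (simp add: lp_space_finite)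
    \<comment> \<open>Joint summability is checked with \<open>k\<close> outside, where the inner
      sum over a column is explicit, and then transferred to the other order.\<close>
    have sK: "(\<lambda>(k, j). K j k * norm (f k) powr ?P) summable_on UNIV \<times> UNIV"
    proof (rule summable_on_SigmaI)
      show "((\<lambda>j. case (k, j) of (k, j) \<Rightarrow> K j k * norm (f k) powr ?P) has_sum 1 * norm (f k) powr ?P) UNIV" for k
        unfolding prod.case using kernel_column by (intro has_sum_cmult_left) (auto simp: has_sum_iff)
    qed (use sf kernel_nonneg in auto)
    have sK': "(\<lambda>(j, k). K j k * norm (f k) powr ?P) summable_on UNIV \<times> UNIV"
      using sK summable_on_swap[of "\<lambda>(j, k). K j k * norm (f k) powr ?P" UNIV UNIV] by simp
    have sj: "(\<lambda>j. \<Sum>\<^sub>\<infinity>k. K j k * norm (f k) powr ?P) summable_on UNIV"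
      using summable_on_Sigma_banach[OF sK'] by simp
    obtain R where R: "\<And>i. norm (f i) \<le> R" using lp_space_bounded[OF p f] by blast
    have le: "norm (?h j) powr ?P \<le> (\<Sum>\<^sub>\<infinity>k. K j k * norm (f k) powr ?P)" for j
      unfolding n by (rule kernel_avg_powr_le[OF P R])
    have sh: "(\<lambda>j. norm (?h j) powr ?P) summable_on UNIV"
      by (rule summable_on_comparison_test[OF sj le]) auto
    have "(\<Sum>\<^sub>\<infinity>j. norm (?h j) powr ?P) \<le> (\<Sum>\<^sub>\<infinity>j. \<Sum>\<^sub>\<infinity>k. K j k * norm (f k) powr ?P)"
      by (rule infsum_mono[OF sh sj le])
    also have "\<dots> = (\<Sum>\<^sub>\<infinity>k. \<Sum>\<^sub>\<infinity>j. K j k * norm (f k) powr ?P)"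
      by (rule infsum_swap_banach[OF sK'])
    also have "\<dots> = (\<Sum>\<^sub>\<infinity>k. norm (f k) powr ?P)"
      by (intro infsum_cong) (simp add: infsum_cmult_left' kernel_column)
    finally show ?thesis
      using sh fin lp_norm_le_iff[OF p fin lp_norm_nonneg[OF fin], of ?h f]
      by (simp add: lp_space_finite lp_norm_powr[OF p fin] del: norm_of_real)
  qed
  then show "?h \<in> lp_space p" "lp_norm p ?h \<le> lp_norm p f" by auto
qed

end

subsection \<open>Commutators of dominated tensors\<close>

lemma infsum_tail_le:
  fixes v :: "'i \<Rightarrow> real"
  assumes "v summable_on UNIV" "0 < e"
  obtains F where "finite F" "(\<Sum>\<^sub>\<infinity>i\<in>-F. v i) \<le> e"
proof -
  obtain F where F: "finite F" "dist (sum v F) (infsum v UNIV) \<le> e"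
    using infsum_finite_approximation[OF assms] by blast
  have "infsum v UNIV = infsum v F + infsum v (- F)"
    using infsum_Un_disjoint[of v F "- F"] assms(1) F(1)
    by (simp add: summable_on_subset_banach[of v UNIV])
  then have "(\<Sum>\<^sub>\<infinity>i\<in>-F. v i) \<le> e" using F by (simp add: dist_real_def)
  then show thesis using that F(1) by blast
qed

lemma finite_superlevel_imp_bounded:
  fixes b :: "'i \<Rightarrow> 'a::real_normed_vector"
  assumes "finite {j. e \<le> norm (b j)}"
  obtains M where "0 \<le> M" "\<And>j. norm (b j) \<le> M"
proof -
  \<comment> \<open>Inserting \<open>max 0 e\<close> makes the set nonempty, keeps \<open>M\<close>
    nonnegative and covers the indices outside the superlevel set.\<close>
  define M where "M = Max (insert (max 0 e) ((\<lambda>j. norm (b j)) ` {j. e \<le> norm (b j)}))"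
  have fin: "finite (insert (max 0 e) ((\<lambda>j. norm (b j)) ` {j. e \<le> norm (b j)}))"
    using assms by simp
  have M: "max 0 e \<le> M" unfolding M_def by (rule Max_ge[OF fin]) simp
  have "norm (b j) \<le> M" for j
  proof (cases "e \<le> norm (b j)")
    case True
    then show ?thesis unfolding M_def by (intro Max_ge[OF fin]) simp
  next
    case False
    then show ?thesis using M by simp
  qed
  then show thesis using that M by auto
qed

section \<open>Operators of tensors dominated by a product kernel, and their first
  commutator\<close>

context
  fixes K :: "'i \<Rightarrow> 'i \<Rightarrow> real" and \<Theta> :: "'i \<Rightarrow> 'i \<Rightarrow> 'i \<Rightarrow> complex" and C :: real
  assumes K: "bistochastic K" and C: "0 \<le> C"
    and \<Theta>: "\<And>j k l. norm (\<Theta> j k l) \<le> C * (K j k * K j l)"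
begin

text \<open>The majorant is a product of two single series, so the double series converges
  absolutely and its bound factorises into averages. The iterated sum may then be treated as a sum
  over pairs.\<close>

lemma tensor_op_dominated:
  fixes f g :: "'i \<Rightarrow> complex"
  assumes f: "\<And>k. norm (f k) \<le> R" and g: "\<And>k. norm (g k) \<le> R'"
  shows "(\<lambda>x. norm (case x of (k, l) \<Rightarrow> \<Theta> j k l * f k * g l)) summable_on UNIV \<times> UNIV"
    and "norm (tensor_op \<Theta> f g j) \<le> C * (kernel_avg K f j * kernel_avg K g j)"
    and "tensor_op \<Theta> f g j = (\<Sum>\<^sub>\<infinity>(k, l)\<in>UNIV \<times> UNIV. \<Theta> j k l * f k * g l)"
proof -
  let ?f = "\<lambda>k. K j k * norm (f k)" and ?g = "\<lambda>k. K j k * norm (g k)"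
  let ?\<Theta> = "\<lambda>(k, l). \<Theta> j k l * f k * g l"
  have sf: "?f summable_on UNIV" using f by (intro kernel_mult_summable[OF K, of _ R]) simp
  have sg: "?g summable_on UNIV" using g by (intro kernel_mult_summable[OF K, of _ R']) simp
  have s: "(\<lambda>(k, l). ?f k * ?g l) summable_on UNIV \<times> UNIV"
  proof (rule summable_on_SigmaI)
    show "((\<lambda>l. case (k, l) of (k, l) \<Rightarrow> ?f k * ?g l) has_sum ?f k * infsum ?g UNIV) UNIV" for k
      unfolding prod.case using sg by (intro has_sum_cmult_right) simp
    show "(\<lambda>k. ?f k * infsum ?g UNIV) summable_on UNIV"
      by (intro summable_on_cmult_left sf)
  qed (use kernel_nonneg[OF K] in auto)
  have eq: "(\<Sum>\<^sub>\<infinity>(k, l)\<in>UNIV \<times> UNIV. ?f k * ?g l) = kernel_avg K f j * kernel_avg K g j"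
    unfolding infsum_Sigma'_banach[OF s, symmetric] kernel_avg_def
    by (simp only: infsum_cmult_right' infsum_cmult_left')
  have sC: "(\<lambda>x. C * (case x of (k, l) \<Rightarrow> ?f k * ?g l)) summable_on UNIV \<times> UNIV"
    by (intro summable_on_cmult_right s)
  have le: "norm (?\<Theta> x) \<le> C * (case x of (k, l) \<Rightarrow> ?f k * ?g l)" for x
  proof (cases x)
    case (Pair k l)
    have "norm (\<Theta> j k l) * (norm (f k) * norm (g l)) \<le> C * (K j k * K j l) * (norm (f k) * norm (g l))"
      by (intro mult_right_mono \<Theta>) simp
    then show ?thesis by (simp add: Pair norm_mult mult_ac)
  qed
  show abs: "(\<lambda>x. norm (?\<Theta> x)) summable_on UNIV \<times> UNIV"
    by (rule Infinite_Sum.abs_summable_on_comparison_test'[OF sC le])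
  have sum: "?\<Theta> summable_on UNIV \<times> UNIV" by (rule abs_summable_summable[OF abs])
  show T: "tensor_op \<Theta> f g j = (\<Sum>\<^sub>\<infinity>(k, l)\<in>UNIV \<times> UNIV. \<Theta> j k l * f k * g l)"
    unfolding tensor_op_def by (rule infsum_Sigma'_banach[OF sum])
  have "norm (\<Sum>\<^sub>\<infinity>x\<in>UNIV \<times> UNIV. ?\<Theta> x) \<le> (\<Sum>\<^sub>\<infinity>x\<in>UNIV \<times> UNIV. norm (?\<Theta> x))"
    by (rule norm_infsum_bound[OF abs])
  also have "\<dots> \<le> (\<Sum>\<^sub>\<infinity>x\<in>UNIV \<times> UNIV. C * (case x of (k, l) \<Rightarrow> ?f k * ?g l))"
    by (rule infsum_mono[OF abs sC le])
  also have "\<dots> = C * (kernel_avg K f j * kernel_avg K g j)"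
    by (subst infsum_cmult_right') (simp only: eq)
  finally show "norm (tensor_op \<Theta> f g j) \<le> C * (kernel_avg K f j * kernel_avg K g j)"
    unfolding T .
qed

lemma tensor_sums_convergeI:
  fixes f g :: "'i \<Rightarrow> complex"
  assumes "\<And>k. norm (f k) \<le> R" "\<And>k. norm (g k) \<le> R'"
  shows "tensor_sums_converge \<Theta> f g"
  unfolding tensor_sums_converge_def
proof (intro allI conjI)
  fix j k
  have s: "(\<lambda>(k, l). \<Theta> j k l * f k * g l) summable_on UNIV \<times> UNIV"
    by (rule abs_summable_summable[OF tensor_op_dominated(1)[OF assms]])
  show "(\<lambda>l. \<Theta> j k l * f k * g l) summable_on UNIV"
    using summable_on_SigmaD1[OF s] by blast
  show "(\<lambda>k. \<Sum>\<^sub>\<infinity>l. \<Theta> j k l * f k * g l) summable_on UNIV"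
    using summable_on_Sigma_banach[OF s] by (simp only: prod.case)
qed

text \<open>Additivity of an infinite sum requires both families to be summable; boundedness of the
  sequences supplies this through the kernel majorant.\<close>

lemma tensor_op_linear:
  fixes f f' g g' :: "'i \<Rightarrow> complex"
  assumes f: "\<And>k. norm (f k) \<le> R" "\<And>k. norm (f' k) \<le> R"
    and g: "\<And>k. norm (g k) \<le> R'" "\<And>k. norm (g' k) \<le> R'"
  shows "tensor_op \<Theta> (\<lambda>k. f k + f' k) g j = tensor_op \<Theta> f g j + tensor_op \<Theta> f' g j"
    and "tensor_op \<Theta> f (\<lambda>k. g k + g' k) j = tensor_op \<Theta> f g j + tensor_op \<Theta> f g' j"
    and "tensor_op \<Theta> (\<lambda>k. c * f k) g j = c * tensor_op \<Theta> f g j"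
    and "tensor_op \<Theta> f (\<lambda>k. c * g k) j = c * tensor_op \<Theta> f g j"
proof -
  note s = abs_summable_summable[OF tensor_op_dominated(1)]
  have ff: "norm (f k + f' k) \<le> R + R" and gg: "norm (g k + g' k) \<le> R' + R'" for k
    by (intro norm_triangle_le add_mono f g)+
  have cf: "norm (c * f k) \<le> norm c * R" and cg: "norm (c * g k) \<le> norm c * R'" for k
    using f g by (auto simp: norm_mult intro: mult_left_mono)
  show "tensor_op \<Theta> (\<lambda>k. f k + f' k) g j = tensor_op \<Theta> f g j + tensor_op \<Theta> f' g j"
    unfolding tensor_op_dominated(3)[OF f(1) g(1)] tensor_op_dominated(3)[OF f(2) g(1)] tensor_op_dominated(3)[OF ff g(1)]
    by (subst infsum_add[symmetric, OF s[OF f(1) g(1)] s[OF f(2) g(1)]])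
      (auto intro!: infsum_cong simp: algebra_simps)
  show "tensor_op \<Theta> f (\<lambda>k. g k + g' k) j = tensor_op \<Theta> f g j + tensor_op \<Theta> f g' j"
    unfolding tensor_op_dominated(3)[OF f(1) g(1)] tensor_op_dominated(3)[OF f(1) g(2)] tensor_op_dominated(3)[OF f(1) gg]
    by (subst infsum_add[symmetric, OF s[OF f(1) g(1)] s[OF f(1) g(2)]])
      (auto intro!: infsum_cong simp: algebra_simps)
  show "tensor_op \<Theta> (\<lambda>k. c * f k) g j = c * tensor_op \<Theta> f g j"
    unfolding tensor_op_dominated(3)[OF f(1) g(1)] tensor_op_dominated(3)[OF cf g(1)]
    by (subst infsum_cmult_right'[symmetric]) (auto intro!: infsum_cong simp: algebra_simps)
  show "tensor_op \<Theta> f (\<lambda>k. c * g k) j = c * tensor_op \<Theta> f g j"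
    unfolding tensor_op_dominated(3)[OF f(1) g(1)] tensor_op_dominated(3)[OF f(1) cg]
    by (subst infsum_cmult_right'[symmetric]) (auto intro!: infsum_cong simp: algebra_simps)
qed

text \<open>The pointwise majorant is a product of two averages, which lie in the original spaces;
  Hoelder puts the product in \<open>lp_space r\<close>.\<close>

lemma tensor_op_lp:
  assumes "1 \<le> p" "1 \<le> q" "1 \<le> r" "r < \<infinity>" "1 / p + 1 / q = 1 / r"
    and f: "f \<in> lp_space p" and g: "g \<in> lp_space q"
  shows "tensor_op \<Theta> f g \<in> lp_space r"
proof -
  obtain R where R: "\<And>k. norm (f k) \<le> R" using lp_space_bounded[OF assms(1) f] by blast
  obtain R' where R': "\<And>k. norm (g k) \<le> R'" using lp_space_bounded[OF assms(2) g] by blast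
  show ?thesis
  proof (rule lp_space_dominated[OF assms(3) _ _ C])
    show "(\<lambda>j. complex_of_real (kernel_avg K f j) * complex_of_real (kernel_avg K g j)) \<in> lp_space r"
      by (rule lp_mult(1)[OF assms(1-5) kernel_avg_lp(1)[OF K assms(1) f] kernel_avg_lp(1)[OF K assms(2) g]])
    show "norm (tensor_op \<Theta> f g j)
        \<le> C * norm (complex_of_real (kernel_avg K f j) * complex_of_real (kernel_avg K g j))" for j
      using tensor_op_dominated(2)[of f R g R' j, OF R R'] kernel_avg_nonneg[OF K] by (simp add: norm_mult)
  qed
qed

lemma commutator1_bilinear:
  assumes pqr: "1 \<le> p" "1 \<le> q" "1 \<le> r" "r < \<infinity>" "1 / p + 1 / q = 1 / r"
    and M: "\<And>j. norm (b j) \<le> M"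
  shows "bilinear_op (lp_space p) (lp_space q) (lp_space r) (commutator1 (tensor_op \<Theta>) b)"
proof -
  have M0: "0 \<le> M" using M norm_ge_zero order_trans by blast
  have bf: "(\<lambda>k. b k * f k) \<in> lp_space s" if "f \<in> lp_space s" "1 \<le> s" for f and s :: ennreal
    by (rule lp_space_dominated[OF that(2,1) _ M0]) (simp add: norm_mult mult_right_mono M)
  have mem: "commutator1 (tensor_op \<Theta>) b f g \<in> lp_space r" if "f \<in> lp_space p" "g \<in> lp_space q" for f g
    unfolding commutator1_def
    by (rule lp_space_diff[OF pqr(3,4) tensor_op_lp[OF pqr bf[OF that(1) pqr(1)] that(2)]
          bf[OF tensor_op_lp[OF pqr that] pqr(3)]])
  have add1: "commutator1 (tensor_op \<Theta>) b (\<lambda>i. f i + f' i) g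
      = (\<lambda>j. commutator1 (tensor_op \<Theta>) b f g j + commutator1 (tensor_op \<Theta>) b f' g j)"
    and add2: "commutator1 (tensor_op \<Theta>) b f (\<lambda>i. g i + g' i)
      = (\<lambda>j. commutator1 (tensor_op \<Theta>) b f g j + commutator1 (tensor_op \<Theta>) b f g' j)"
    and sc1: "commutator1 (tensor_op \<Theta>) b (\<lambda>i. c * f i) g
      = (\<lambda>j. c * commutator1 (tensor_op \<Theta>) b f g j)"
    and sc2: "commutator1 (tensor_op \<Theta>) b f (\<lambda>i. c * g i)
      = (\<lambda>j. c * commutator1 (tensor_op \<Theta>) b f g j)"
    if f: "f \<in> lp_space p" "f' \<in> lp_space p" and g: "g \<in> lp_space q" "g' \<in> lp_space q" for f f' g g' c
  proof -
    obtain R1 where R1: "\<And>k. norm (f k) \<le> R1" using lp_space_bounded[OF pqr(1) f(1)] by blast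
    obtain R2 where R2: "\<And>k. norm (f' k) \<le> R2" using lp_space_bounded[OF pqr(1) f(2)] by blast
    obtain R3 where R3: "\<And>k. norm (g k) \<le> R3" using lp_space_bounded[OF pqr(2) g(1)] by blast
    obtain R4 where R4: "\<And>k. norm (g' k) \<le> R4" using lp_space_bounded[OF pqr(2) g(2)] by blast
    \<comment> \<open>\<open>tensor_op_linear\<close> takes one bound common to both summands, hence
      the maxima.\<close>
    have 1: "norm (f k) \<le> max R1 R2" "norm (f' k) \<le> max R1 R2" for k
      using R1[of k] R2[of k] by auto
    have 2: "norm (b k * f k) \<le> M * max R1 R2" "norm (b k * f' k) \<le> M * max R1 R2" for k
      using 1[of k] M0 by (auto simp: norm_mult intro!: mult_mono M)
    have 3: "norm (g k) \<le> max R3 R4" "norm (g' k) \<le> max R3 R4" for k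
      using R3[of k] R4[of k] by auto
    note lin = tensor_op_linear[OF 1 3] tensor_op_linear[OF 2 3]
    have r: "b k * (f k + f' k) = b k * f k + b k * f' k" "b k * (c * f k) = c * (b k * f k)" for k
      by (simp_all add: algebra_simps)
    show "commutator1 (tensor_op \<Theta>) b (\<lambda>i. f i + f' i) g
      = (\<lambda>j. commutator1 (tensor_op \<Theta>) b f g j + commutator1 (tensor_op \<Theta>) b f' g j)"
      unfolding commutator1_def r lin by (simp add: algebra_simps)
    show "commutator1 (tensor_op \<Theta>) b f (\<lambda>i. g i + g' i)
      = (\<lambda>j. commutator1 (tensor_op \<Theta>) b f g j + commutator1 (tensor_op \<Theta>) b f g' j)"
      unfolding commutator1_def lin by (simp add: algebra_simps)
    show "commutator1 (tensor_op \<Theta>) b (\<lambda>i. c * f i) g = (\<lambda>j. c * commutator1 (tensor_op \<Theta>) b f g j)"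
      unfolding commutator1_def r lin by (simp add: algebra_simps)
    show "commutator1 (tensor_op \<Theta>) b f (\<lambda>i. c * g i) = (\<lambda>j. c * commutator1 (tensor_op \<Theta>) b f g j)"
      unfolding commutator1_def lin by (simp add: algebra_simps)
  qed
  show ?thesis unfolding bilinear_op_def
    by (intro conjI allI ballI mem add1 add2 sc1 sc2)
qed

text \<open>Both terms of the commutator are estimated separately, with \<open>b\<close> split at
  \<open>F\<close>. The finite part gives a majorant independent of \<open>f\<close> and
  \<open>g\<close>; each term contributes one share of \<open>e\<close>, hence the factor 2.\<close>

lemma commutator1_bound:
  fixes b f g :: "'i \<Rightarrow> complex"
  assumes M: "\<And>j. norm (b j) \<le> M" and F: "finite F" "\<And>j. j \<notin> F \<Longrightarrow> norm (b j) \<le> e" and e: "0 \<le> e"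
    and f: "\<And>k. norm (f k) \<le> 1" and g: "\<And>k. norm (g k) \<le> 1"
  shows "norm (commutator1 (tensor_op \<Theta>) b f g j)
    \<le> C * M * ((\<Sum>k\<in>F. K j k) + indicator F j) + 2 * C * e * (kernel_avg K f j * kernel_avg K g j)"
proof -
  let ?f = "kernel_avg K f j" and ?g = "kernel_avg K g j"
  note nn = kernel_avg_nonneg[OF K] kernel_nonneg[OF K]
  have M0: "0 \<le> M" using M norm_ge_zero order_trans by blast
  have f1: "?f \<le> 1" "?g \<le> 1"
    using kernel_avg_le[OF K, of f 1] kernel_avg_le[OF K, of g 1] f g by auto
  have fg1: "?f * ?g \<le> 1" using f1 nn by (simp add: mult_le_one)
  have bf: "norm (b k * f k) \<le> M" for k
    using mult_mono[OF M[of k] f[of k] M0] by (simp add: norm_mult)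
  have avg_bf: "kernel_avg K (\<lambda>k. b k * f k) j \<le> M * (\<Sum>k\<in>F. K j k) + e * ?f"
  proof -
    have "((\<lambda>k. if k \<in> F then M * K j k else 0) has_sum (\<Sum>k\<in>F. M * K j k)) UNIV"
      by (rule has_sum_finite_neutralI[OF F(1)]) auto
    moreover have "((\<lambda>k. e * (K j k * norm (f k))) has_sum e * ?f) UNIV"
      using kernel_mult_summable[OF K, of "\<lambda>k. norm (f k)" 1] f
      by (intro has_sum_cmult_right) (simp add: kernel_avg_def)
    ultimately have *: "((\<lambda>k. (if k \<in> F then M * K j k else 0) + e * (K j k * norm (f k)))
        has_sum (\<Sum>k\<in>F. M * K j k) + e * ?f) UNIV"
      by (rule has_sum_add)
    have **: "((\<lambda>k. K j k * norm (b k * f k)) has_sum kernel_avg K (\<lambda>k. b k * f k) j) UNIV"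
      using kernel_mult_summable[OF K, of "\<lambda>k. norm (b k * f k)" M] bf
      by (simp add: kernel_avg_def)
    have "kernel_avg K (\<lambda>k. b k * f k) j \<le> (\<Sum>k\<in>F. M * K j k) + e * ?f"
    proof (rule has_sum_mono[OF ** *])
      fix k
      show "K j k * norm (b k * f k) \<le> (if k \<in> F then M * K j k else 0) + e * (K j k * norm (f k))"
      proof (cases "k \<in> F")
        case True
        have "K j k * norm (b k * f k) \<le> K j k * M" by (intro mult_left_mono bf nn)
        then show ?thesis using True nn e by (simp add: mult.commute add_increasing2)
      next
        case False
        have "K j k * norm (b k * f k) \<le> K j k * (e * norm (f k))"
          unfolding norm_mult by (intro mult_left_mono mult_right_mono F(2) False nn) auto
        then show ?thesis using False by (simp add: mult_ac)
      qed
    qed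
    then show ?thesis by (simp add: sum_distrib_left)
  qed
  have "norm (tensor_op \<Theta> (\<lambda>k. b k * f k) g j) \<le> C * (kernel_avg K (\<lambda>k. b k * f k) j * ?g)"
    by (rule tensor_op_dominated(2)[OF bf g])
  also have "\<dots> \<le> C * ((M * (\<Sum>k\<in>F. K j k) + e * ?f) * ?g)"
    by (intro mult_left_mono mult_right_mono avg_bf nn C)
  also have "\<dots> = C * (M * (\<Sum>k\<in>F. K j k) * ?g + e * (?f * ?g))"
    by (simp add: algebra_simps)
  \<comment> \<open>Only the part from \<open>F\<close> drops its average of \<open>g\<close>. The
    part with \<open>e\<close> keeps both averages, since their product is what Hoelder controls in
    \<open>lp_space r\<close>.\<close>
  also have "\<dots> \<le> C * (M * (\<Sum>k\<in>F. K j k) * 1 + e * (?f * ?g))"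
    by (intro mult_left_mono add_right_mono f1 C mult_nonneg_nonneg M0 sum_nonneg nn)
  finally have 1: "norm (tensor_op \<Theta> (\<lambda>k. b k * f k) g j)
      \<le> C * M * (\<Sum>k\<in>F. K j k) + C * e * (?f * ?g)"
    by (simp add: algebra_simps)
  have "norm (b j * tensor_op \<Theta> f g j) \<le> norm (b j) * (C * (?f * ?g))"
    unfolding norm_mult by (intro mult_left_mono tensor_op_dominated(2)[OF f g]) simp
  also have "\<dots> \<le> C * M * indicator F j + C * e * (?f * ?g)"
  proof (cases "j \<in> F")
    case True
    have "norm (b j) * (C * (?f * ?g)) \<le> M * (C * 1)"
      by (intro mult_mono M mult_left_mono fg1 C M0 mult_nonneg_nonneg nn)
    moreover have "0 \<le> C * e * (?f * ?g)" using C e nn by simp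
    ultimately show ?thesis using True by (simp add: mult.commute)
  next
    case False
    have "norm (b j) * (C * (?f * ?g)) \<le> e * (C * (?f * ?g))"
      using False by (intro mult_right_mono F(2) mult_nonneg_nonneg C nn) 
    then show ?thesis using False by (simp add: mult_ac)
  qed
  finally have 2: "norm (b j * tensor_op \<Theta> f g j) \<le> C * M * indicator F j + C * e * (?f * ?g)" .
  have "norm (commutator1 (tensor_op \<Theta>) b f g j)
      \<le> norm (tensor_op \<Theta> (\<lambda>k. b k * f k) g j) + norm (b j * tensor_op \<Theta> f g j)"
    unfolding commutator1_def by (rule norm_triangle_ineq4)
  then show ?thesis using 1 2 by (simp add: algebra_simps)
qed

text \<open>The pointwise bound consists of a fixed sequence \<open>v\<close>, whose tail is small,
  and a multiple of a product \<open>H\<close> in the unit ball, small over the whole lattice. Hence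
  one \<open>F\<close> serves all \<open>f\<close> and \<open>g\<close>.\<close>

lemma commutator1_tails:
  fixes b :: "'i \<Rightarrow> complex"
  assumes pqr: "1 \<le> p" "1 \<le> q" "1 \<le> r" "r < \<infinity>" "1 / p + 1 / q = 1 / r"
    and M: "\<And>j. norm (b j) \<le> M" and b: "\<And>e. 0 < e \<Longrightarrow> finite {j. e \<le> norm (b j)}"
    and e: "0 < e"
  obtains F where "finite F"
    "\<And>f g. \<lbrakk>f \<in> lp_space p; g \<in> lp_space q; lp_norm p f \<le> 1; lp_norm q g \<le> 1\<rbrakk> \<Longrightarrow>
       (\<Sum>\<^sub>\<infinity>j\<in>-F. norm (commutator1 (tensor_op \<Theta>) b f g j) powr enn2real r) \<le> e"
proof -
  define P where "P = enn2real r"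
  have P: "1 \<le> P" using enn2real_ge_1[OF pqr(3,4)] by (simp add: P_def)
  have M0: "0 \<le> M" using M norm_ge_zero order_trans by blast
  \<comment> \<open>Chosen so that \<open>2 powr P * (e / (2 * 2 powr P) + s powr P) = e\<close> in
    the final estimate.\<close>
  define s where "s = (e / (2 * 2 powr P)) powr (1 / P)"
  \<comment> \<open>This level for splitting \<open>b\<close> ensures
    \<open>2 * C * \<epsilon> \<le> s\<close>; the \<open>+ 1\<close> allows for
    \<open>C = 0\<close>.\<close>
  define \<epsilon> where "\<epsilon> = s / (2 * C + 1)"
  have s: "0 < s" "s powr P = e / (2 * 2 powr P)" using e P by (auto simp: s_def powr_powr)
  have \<epsilon>: "0 < \<epsilon>" "2 * C * \<epsilon> \<le> s"
    using s C by (auto simp: \<epsilon>_def field_simps)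
  define G where "G = {j. \<epsilon> \<le> norm (b j)}"
  have G: "finite G" "\<And>j. j \<notin> G \<Longrightarrow> norm (b j) \<le> \<epsilon>"
    using b[OF \<epsilon>(1)] by (auto simp: G_def)
  define v where "v j = C * M * ((\<Sum>k\<in>G. K j k) + indicator G j)" for j
  have v0: "0 \<le> v j" for j
    using C M0 kernel_nonneg[OF K] by (auto simp: v_def intro!: mult_nonneg_nonneg add_nonneg_nonneg sum_nonneg)
  have sv: "v summable_on UNIV"
  proof -
    have "(\<lambda>j. \<Sum>k\<in>G. K j k) summable_on UNIV"
      using G(1) by (induction rule: finite_induct) (auto intro!: summable_on_add kernel_column[OF K])
    moreover have "((\<lambda>j. indicator G j) has_sum (\<Sum>j\<in>G. 1::real)) UNIV"
      by (rule has_sum_finite_neutralI[OF G(1)]) auto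
    ultimately show ?thesis unfolding v_def
      by (intro summable_on_cmult_right summable_on_add) (auto simp: summable_on_def)
  qed
  define V where "V = C * M * (real (card G) + 1)"
  have "v j \<le> V" for j
  proof -
    have "(\<Sum>k\<in>G. K j k) \<le> real (card G) * 1"
      by (rule sum_bounded_above) (rule kernel_le_1[OF K])
    then show ?thesis unfolding v_def V_def
      using C M0 by (intro mult_left_mono add_mono) (auto simp: indicator_def)
  qed
  \<comment> \<open>A summable sequence bounded by \<open>V\<close> has summable \<open>P\<close>-th
    powers: \<open>P - 1\<close> of the factors are replaced by \<open>V\<close>.\<close>
  have svP: "(\<lambda>j. v j powr P) summable_on UNIV"
  proof (rule summable_on_comparison_test)
    show "(\<lambda>j. V powr (P - 1) * v j) summable_on UNIV"
      by (intro summable_on_cmult_right sv)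
    show "v j powr P \<le> V powr (P - 1) * v j" for j
    proof (cases "v j = 0")
      case False
      then have "v j powr P = v j powr (P - 1) * v j"
        using v0[of j] by (simp add: powr_diff)
      also have "\<dots> \<le> V powr (P - 1) * v j"
        using v0[of j] \<open>v j \<le> V\<close> P by (intro mult_right_mono powr_mono2) auto
      finally show ?thesis .
    qed auto
  qed auto
  \<comment> \<open>Since \<open>v\<close> involves neither \<open>f\<close> nor \<open>g\<close>,
    this set is fixed before they are introduced.\<close>
  obtain F where F: "finite F" "(\<Sum>\<^sub>\<infinity>j\<in>-F. v j powr P) \<le> e / (2 * 2 powr P)"
    using infsum_tail_le[OF svP, of "e / (2 * 2 powr P)"] e by auto
  have "(\<Sum>\<^sub>\<infinity>j\<in>-F. norm (commutator1 (tensor_op \<Theta>) b f g j) powr P) \<le> e"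
    if f: "f \<in> lp_space p" "lp_norm p f \<le> 1" and g: "g \<in> lp_space q" "lp_norm q g \<le> 1" for f g
  proof -
    define H where "H j = kernel_avg K f j * kernel_avg K g j" for j
    let ?H = "\<lambda>j. complex_of_real (kernel_avg K f j) * complex_of_real (kernel_avg K g j)"
    have H0: "0 \<le> H j" for j using kernel_avg_nonneg[OF K] by (simp add: H_def)
    have nH: "norm (?H j) = H j" for j using H0[of j] by (simp add: H_def flip: of_real_mult)
    have HP: "(\<lambda>j. H j powr P) summable_on UNIV" "(\<Sum>\<^sub>\<infinity>j. H j powr P) \<le> 1"
    proof -
      note af = kernel_avg_lp[OF K pqr(1) f(1)] and ag = kernel_avg_lp[OF K pqr(2) g(1)]
      have "?H \<in> lp_space r" by (rule lp_mult(1)[OF pqr af(1) ag(1)])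
      then show "(\<lambda>j. H j powr P) summable_on UNIV"
        using pqr(4) by (simp add: lp_space_finite nH P_def del: norm_mult norm_of_real)
      have "lp_norm r ?H \<le> 1"
        using af(2) ag(2) f(2) g(2) by (intro lp_mult(2)[OF pqr af(1) ag(1)]) auto
      then show "(\<Sum>\<^sub>\<infinity>j. H j powr P) \<le> 1"
        using lp_norm_le_iff[OF pqr(3,4), of 1 ?H] by (simp add: nH P_def)
    qed
    have HPF: "(\<lambda>j. H j powr P) summable_on - F" "(\<Sum>\<^sub>\<infinity>j\<in>-F. H j powr P) \<le> 1"
    proof -
      show 1: "(\<lambda>j. H j powr P) summable_on - F"
        using HP(1) by (rule summable_on_subset_banach) simp
      have "(\<Sum>\<^sub>\<infinity>j\<in>-F. H j powr P) \<le> (\<Sum>\<^sub>\<infinity>j. H j powr P)"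
        by (rule infsum_mono2[OF 1 HP(1)]) auto
      then show "(\<Sum>\<^sub>\<infinity>j\<in>-F. H j powr P) \<le> 1" using HP(2) by simp
    qed
    have vF: "(\<lambda>j. v j powr P) summable_on - F"
      using svP by (rule summable_on_subset_banach) simp
    have f1: "norm (f k) \<le> 1" and g1: "norm (g k) \<le> 1" for k
      using lp_norm_ge_coord[OF pqr(1) f(1), of k] lp_norm_ge_coord[OF pqr(2) g(1), of k] f g by auto
    let ?h = "commutator1 (tensor_op \<Theta>) b f g"
    have pt: "norm (?h j) powr P \<le> 2 powr P * (v j powr P + s powr P * H j powr P)" for j
    proof -
      have "norm (?h j) \<le> v j + 2 * C * \<epsilon> * H j"
        unfolding v_def H_def using \<epsilon>(1)
        by (intro commutator1_bound[OF M G _ f1 g1]) auto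
      also have "\<dots> \<le> v j + s * H j"
        by (intro add_left_mono mult_right_mono \<epsilon> H0)
      finally have "norm (?h j) powr P \<le> (v j + s * H j) powr P"
        using P by (intro powr_mono2) auto
      also have "\<dots> \<le> 2 powr P * (v j powr P + (s * H j) powr P)"
        using P s(1) H0 v0 by (intro powr_add_le_two_powr) auto
      finally show ?thesis using s(1) H0 by (simp add: powr_mult)
    qed
    have sR: "(\<lambda>j. 2 powr P * (v j powr P + s powr P * H j powr P)) summable_on - F"
      by (intro summable_on_cmult_right summable_on_add vF HPF)
    have "(\<Sum>\<^sub>\<infinity>j\<in>-F. norm (?h j) powr P)
        \<le> (\<Sum>\<^sub>\<infinity>j\<in>-F. 2 powr P * (v j powr P + s powr P * H j powr P))"
      by (rule infsum_mono[OF summable_on_comparison_test[OF sR pt] sR pt]) auto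
    also have "\<dots> = 2 powr P * ((\<Sum>\<^sub>\<infinity>j\<in>-F. v j powr P) + s powr P * (\<Sum>\<^sub>\<infinity>j\<in>-F. H j powr P))"
      unfolding infsum_cmult_right'
      by (subst infsum_add) (auto intro!: vF summable_on_cmult_right HPF simp: infsum_cmult_right')
    also have "\<dots> \<le> 2 powr P * (e / (2 * 2 powr P) + s powr P * 1)"
      by (intro mult_left_mono add_mono F HPF) auto
    also have "\<dots> = e" using s by simp
    finally show ?thesis .
  qed
  then show thesis using that[OF F(1)] by (simp add: P_def)
qed

lemma commutator1_compact:
  fixes b :: "'i \<Rightarrow> complex"
  assumes pqr: "1 \<le> p" "1 \<le> q" "1 \<le> r" "r < \<infinity>" "1 / p + 1 / q = 1 / r"
    and b: "\<And>e. 0 < e \<Longrightarrow> finite {j. e \<le> norm (b j)}"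
  shows "compact_bilinear_op (lp_space p) (lp_norm p) (lp_space q) (lp_norm q)
      (lp_space r) (lp_norm r) (commutator1 (tensor_op \<Theta>) b)"
proof -
  obtain M where M: "0 \<le> M" "\<And>j. norm (b j) \<le> M"
    using finite_superlevel_imp_bounded[OF b[OF zero_less_one]] by blast
  let ?T = "commutator1 (tensor_op \<Theta>) b"
  let ?S = "{?T f g | f g. f \<in> lp_space p \<and> g \<in> lp_space q \<and> lp_norm p f \<le> 1 \<and> lp_norm q g \<le> 1}"
  have bil: "bilinear_op (lp_space p) (lp_space q) (lp_space r) ?T"
    by (rule commutator1_bilinear[OF pqr M(2)])
  have "compactin (norm_topology (lp_space r) (lp_norm r)) (norm_topology (lp_space r) (lp_norm r) closure_of ?S)"
  proof (rule compactin_lp_closure[OF pqr(3,4)])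
    show "?S \<subseteq> lp_space r" using bil by (auto simp: bilinear_op_def)
    have fin: "finite {j. (1::real) \<le> norm (b j)}" using b[of 1] by simp
    \<comment> \<open>For a uniform coordinate bound any splitting level will do; 1 is
      taken.\<close>
    let ?F = "{j. 1 \<le> norm (b j)}"
    show "norm (h i) \<le> C * M * (real (card ?F) + 1) + 2 * C" if hS: "h \<in> ?S" for h i
    proof -
      obtain f g where h: "h = ?T f g" and f: "f \<in> lp_space p" "lp_norm p f \<le> 1"
        and g: "g \<in> lp_space q" "lp_norm q g \<le> 1"
        using hS by blast
      have f1: "norm (f k) \<le> 1" and g1: "norm (g k) \<le> 1" for k
        using lp_norm_ge_coord[OF pqr(1) f(1), of k] lp_norm_ge_coord[OF pqr(2) g(1), of k] f g by auto
      have "norm (h i) \<le> C * M * ((\<Sum>k\<in>?F. K i k) + indicator ?F i)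
          + 2 * C * 1 * (kernel_avg K f i * kernel_avg K g i)"
        unfolding h by (rule commutator1_bound[OF M(2) fin _ _ f1 g1]) auto
      also have "\<dots> \<le> C * M * (real (card ?F) * 1 + 1) + 2 * C * 1 * 1"
      proof (intro add_mono mult_left_mono)
        show "(\<Sum>k\<in>?F. K i k) \<le> real (card ?F) * 1"
          by (rule sum_bounded_above) (rule kernel_le_1[OF K])
        show "kernel_avg K f i * kernel_avg K g i \<le> 1"
          by (intro mult_le_one kernel_avg_nonneg[OF K] kernel_avg_le[OF K] f1 g1)
      qed (use C M(1) in \<open>auto simp: indicator_def\<close>)
      finally show ?thesis by simp
    qed
    show "\<exists>F. finite F \<and> (\<forall>h\<in>?S. (\<Sum>\<^sub>\<infinity>i\<in>-F. norm (h i) powr enn2real r) \<le> e)" if e: "0 < e" for e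
    proof -
      obtain F where "finite F"
        "\<And>f g. \<lbrakk>f \<in> lp_space p; g \<in> lp_space q; lp_norm p f \<le> 1; lp_norm q g \<le> 1\<rbrakk> \<Longrightarrow>
          (\<Sum>\<^sub>\<infinity>j\<in>-F. norm (?T f g j) powr enn2real r) \<le> e"
        using commutator1_tails[OF pqr M(2) b e] by blast
      then show ?thesis by (intro exI[of _ F] conjI ballI) blast+
    qed
  qed
  then show ?thesis using bil by (simp add: compact_bilinear_op_def)
qed

text \<open>Absolute convergence permits exchanging the sums, which lets the second commutator be
  read as a first commutator.\<close>

lemma tensor_op_swap:
  fixes f g :: "'i \<Rightarrow> complex"
  assumes "\<And>k. norm (f k) \<le> R" "\<And>k. norm (g k) \<le> R'"
  shows "tensor_op \<Theta> f g = tensor_op (\<lambda>j k l. \<Theta> j l k) g f"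
proof
  fix j
  have "tensor_op \<Theta> f g j = (\<Sum>\<^sub>\<infinity>l. \<Sum>\<^sub>\<infinity>k. \<Theta> j k l * f k * g l)"
    unfolding tensor_op_def
    by (rule infsum_swap_banach[OF abs_summable_summable[OF tensor_op_dominated(1)[OF assms]]])
  then show "tensor_op \<Theta> f g j = tensor_op (\<lambda>j k l. \<Theta> j l k) g f j"
    by (simp add: tensor_op_def mult_ac)
qed

end

section \<open>The second commutator by exchange of the arguments\<close>

lemma compact_bilinear_op_swap:
  assumes T': "compact_bilinear_op Y nY X nX Z nZ T'"
    and swap: "\<And>f g. f \<in> X \<Longrightarrow> g \<in> Y \<Longrightarrow> T f g = T' g f"
    and X: "\<And>f f'. f \<in> X \<Longrightarrow> f' \<in> X \<Longrightarrow> (\<lambda>i. f i + f' i) \<in> X" "\<And>c f. f \<in> X \<Longrightarrow> (\<lambda>i. c * f i) \<in> X"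
    and Y: "\<And>g g'. g \<in> Y \<Longrightarrow> g' \<in> Y \<Longrightarrow> (\<lambda>i. g i + g' i) \<in> Y" "\<And>c g. g \<in> Y \<Longrightarrow> (\<lambda>i. c * g i) \<in> Y"
  shows "compact_bilinear_op X nX Y nY Z nZ T"
proof -
  have "T f g \<in> {T' g f | g f. g \<in> Y \<and> f \<in> X \<and> nY g \<le> 1 \<and> nX f \<le> 1}"
    if "f \<in> X" "g \<in> Y" "nX f \<le> 1" "nY g \<le> 1" for f g
    using that swap[OF that(1,2)] by blast
  moreover have "T' g f \<in> {T f g | f g. f \<in> X \<and> g \<in> Y \<and> nX f \<le> 1 \<and> nY g \<le> 1}"
    if "f \<in> X" "g \<in> Y" "nX f \<le> 1" "nY g \<le> 1" for f g
    using that swap[OF that(1,2), symmetric] by blast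
  ultimately have "{T f g | f g. f \<in> X \<and> g \<in> Y \<and> nX f \<le> 1 \<and> nY g \<le> 1}
      = {T' g f | g f. g \<in> Y \<and> f \<in> X \<and> nY g \<le> 1 \<and> nX f \<le> 1}"
    by blast
  \<comment> \<open>The operators agree on \<open>X\<close> times \<open>Y\<close> only, so carrying
    over the linearity laws uses closure of \<open>X\<close> and \<open>Y\<close> under sums and
    multiples.\<close>
  moreover have "bilinear_op X Y Z T"
    using T' unfolding compact_bilinear_op_def bilinear_op_def
    by (simp add: swap X Y)
  ultimately show ?thesis
    using T' by (simp only: compact_bilinear_op_def)
qed

lemma lp_space_add:
  assumes "1 \<le> p" "f \<in> lp_space p" "g \<in> lp_space p"
  shows "(\<lambda>i. f i + g i) \<in> lp_space p"
proof (cases "p = \<infinity>")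
  case True
  obtain R where R: "\<And>i. norm (f i) \<le> R" using lp_space_bounded[OF assms(1,2)] by blast
  obtain R' where R': "\<And>i. norm (g i) \<le> R'" using lp_space_bounded[OF assms(1,3)] by blast
  have "norm (f i + g i) \<le> R + R'" for i using R R' by (intro norm_triangle_le add_mono)
  then show ?thesis using True by (auto simp: lp_space_def intro: bdd_aboveI2[of _ _ "R + R'"])
next
  case False
  then show ?thesis using assms by (intro lp_minkowski(1)) (auto simp: top.not_eq_extremum)
qed

lemma lp_space_cmult:
  assumes "1 \<le> p" "f \<in> lp_space p"
  shows "(\<lambda>i. c * f i) \<in> lp_space p"
  using lp_space_dominated[OF assms, of "\<lambda>i. c * f i" "norm c"] by (simp add: norm_mult)

text \<open>The kernel bound is symmetric in \<open>k\<close> and \<open>l\<close>, so the tensor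
  with these indices exchanged satisfies it too.\<close>

lemma commutator2_compact:
  fixes b :: "'i \<Rightarrow> complex"
  assumes K: "bistochastic K" and C: "0 \<le> C"
    and \<Theta>: "\<And>j k l. norm (\<Theta> j k l) \<le> C * (K j k * K j l)"
    and pqr: "1 \<le> p" "1 \<le> q" "1 \<le> r" "r < \<infinity>" "1 / p + 1 / q = 1 / r"
    and b: "\<And>e. 0 < e \<Longrightarrow> finite {j. e \<le> norm (b j)}"
  shows "compact_bilinear_op (lp_space p) (lp_norm p) (lp_space q) (lp_norm q)
      (lp_space r) (lp_norm r) (commutator2 (tensor_op \<Theta>) b)"
proof -
  let ?\<Theta> = "\<lambda>j k l. \<Theta> j l k"
  have \<Theta>': "norm (?\<Theta> j k l) \<le> C * (K j k * K j l)" for j k l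
    using \<Theta>[of j l k] by (simp add: mult.commute)
  have pqr': "1 / q + 1 / p = 1 / r" using pqr(5) by (simp add: add.commute)
  have 1: "compact_bilinear_op (lp_space q) (lp_norm q) (lp_space p) (lp_norm p)
      (lp_space r) (lp_norm r) (commutator1 (tensor_op ?\<Theta>) b)"
    by (rule commutator1_compact[OF K C \<Theta>' pqr(2,1,3,4) pqr' b])
  have 2: "commutator2 (tensor_op \<Theta>) b f g = commutator1 (tensor_op ?\<Theta>) b g f"
    if f: "f \<in> lp_space p" and g: "g \<in> lp_space q" for f g
  proof -
  obtain R where R: "\<And>k. norm (f k) \<le> R" using lp_space_bounded[OF pqr(1) f] by blast
  obtain R' where R': "\<And>k. norm (g k) \<le> R'" using lp_space_bounded[OF pqr(2) g] by blast
  obtain M where M: "0 \<le> M" "\<And>j. norm (b j) \<le> M"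
    using finite_superlevel_imp_bounded[OF b[OF zero_less_one]] by blast
  have bg: "norm (b k * g k) \<le> M * R'" for k
    unfolding norm_mult by (intro mult_mono M R') auto
  show ?thesis
    unfolding commutator1_def commutator2_def
      tensor_op_swap[OF K C \<Theta> R R'] tensor_op_swap[OF K C \<Theta> R bg] ..
  qed
  show ?thesis
    by (rule compact_bilinear_op_swap[OF 1 2])
      (assumption | rule lp_space_add lp_space_cmult pqr)+
qed

subsection \<open>Weights on the lattice\<close>

text \<open>On each half-line the terms compare with the convergent series of
  \<open>n powr (- s)\<close>.\<close>

lemma summable_on_int_powr:
  fixes s :: real
  assumes s: "1 < s"
  shows "(\<lambda>m::int. (1 + (real_of_int m)\<^sup>2) powr (- s / 2)) summable_on UNIV"
proof -
  let ?g = "\<lambda>m::int. (1 + (real_of_int m)\<^sup>2) powr (- s / 2)"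
  have "summable (\<lambda>n. (1 + (real n)\<^sup>2) powr (- s / 2))"
  proof (rule summable_comparison_test')
    have "summable (\<lambda>n. real n powr (- s))" using s by (simp add: summable_real_powr_iff)
    then have "summable (\<lambda>n. real (Suc n) powr (- s))" by (subst summable_Suc_iff)
    then show "summable (\<lambda>n. (1/2) powr (- s / 2) * real (Suc n) powr (- s))"
      by (rule summable_mult)
    fix n :: nat
    \<comment> \<open>Equivalent to \<open>(n - 1)^2 \<ge> 0\<close>. The shift to
      \<open>Suc n\<close> matters at \<open>n = 0\<close>, where \<open>0 powr (- s) = 0\<close>
      could not dominate the term 1.\<close>
    have "1/2 * (real (Suc n))\<^sup>2 \<le> 1 + (real n)\<^sup>2"
      using sum_squares_ge_zero[of "real n - 1" 0] by (simp add: power2_eq_square algebra_simps)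
    then have "(1 + (real n)\<^sup>2) powr (- s / 2) \<le> (1/2 * (real (Suc n))\<^sup>2) powr (- s / 2)"
      using s by (intro powr_mono2') auto
    also have "\<dots> = (1/2) powr (- s / 2) * ((real (Suc n))\<^sup>2) powr (- s / 2)"
      by (simp only: powr_mult)
    also have "((real (Suc n))\<^sup>2) powr (- s / 2) = real (Suc n) powr (- s)"
      using powr_powr[of "real (Suc n)" 2 "- s / 2"] by simp
    finally show "norm ((1 + (real n)\<^sup>2) powr (- s / 2)) \<le> (1/2) powr (- s / 2) * real (Suc n) powr (- s)"
      by simp
  qed
  then have nat: "(\<lambda>n. (1 + (real n)\<^sup>2) powr (- s / 2)) summable_on UNIV"
    by (rule summable_nonneg_imp_summable_on) simp
  have "?g summable_on range int"
    using nat summable_on_reindex[of int UNIV ?g] by (simp add: o_def)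
  moreover have "?g summable_on range (\<lambda>n. - int n)"
    using nat summable_on_reindex[of "\<lambda>n. - int n" UNIV ?g] by (simp add: o_def inj_def)
  ultimately have "?g summable_on (range int \<union> range (\<lambda>n. - int n))"
    by (rule summable_on_union)
  moreover have "m \<in> range int \<union> range (\<lambda>n. - int n)" for m
    by (cases m rule: int_cases2) auto
  then have "range int \<union> range (\<lambda>n. - int n) = UNIV" by blast
  ultimately show ?thesis by simp
qed

text \<open>A finite set of vectors lies in a box with equal sides \<open>B\<close>, over which the
  sum of products factorises; each factor is at most the full sum of \<phi>.\<close>

lemma summable_on_prod_vec:
  fixes \<phi> :: "'a \<Rightarrow> real"
  assumes \<phi>: "\<phi> summable_on UNIV" "\<And>x. 0 \<le> \<phi> x"
  shows "(\<lambda>m::'a ^ 'd. \<Prod>i\<in>UNIV. \<phi> (m $ i)) summable_on UNIV"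
proof (rule nonneg_bdd_above_summable_on)
  show "0 \<le> (\<Prod>i\<in>UNIV. \<phi> (m $ i))" for m :: "'a ^ 'd"
    using \<phi>(2) by (intro prod_nonneg) auto
  show "bdd_above (sum (\<lambda>m::'a ^ 'd. \<Prod>i\<in>UNIV. \<phi> (m $ i)) ` {F. F \<subseteq> UNIV \<and> finite F})"
  proof (rule bdd_aboveI2)
    fix F :: "('a ^ 'd) set" assume "F \<in> {F. F \<subseteq> UNIV \<and> finite F}"
    then have F: "finite F" by simp
    define B where "B = (\<Union>i. (\<lambda>m. m $ i) ` F)"
    have B: "finite B" using F by (simp add: B_def)
    have inj: "inj_on vec_nth F" by (auto simp: inj_on_def vec_nth_inject)
    have "(\<Sum>m\<in>F. \<Prod>i\<in>UNIV. \<phi> (m $ i)) = (\<Sum>h\<in>vec_nth ` F. \<Prod>i\<in>UNIV. \<phi> (h i))"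
      by (simp add: sum.reindex[OF inj])
    also have "\<dots> \<le> (\<Sum>h\<in>(UNIV::'d set) \<rightarrow>\<^sub>E B. \<Prod>i\<in>UNIV. \<phi> (h i))"
    proof (rule sum_mono2)
      show "finite ((UNIV::'d set) \<rightarrow>\<^sub>E B)" by (intro finite_PiE B) simp
    qed (auto simp: B_def PiE_UNIV_domain intro!: prod_nonneg \<phi>(2))
    also have "\<dots> = (\<Prod>i\<in>(UNIV::'d set). \<Sum>x\<in>B. \<phi> x)"
      by (rule prod_sum_PiE[symmetric]) (use B in auto)
    also have "\<dots> \<le> (\<Prod>i\<in>(UNIV::'d set). infsum \<phi> UNIV)"
      by (intro prod_mono conjI sum_nonneg finite_sum_le_infsum \<phi> B) auto
    finally show "(\<Sum>m\<in>F. \<Prod>i\<in>UNIV. \<phi> (m $ i)) \<le> (\<Prod>i\<in>(UNIV::'d set). infsum \<phi> UNIV)" .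
  qed
qed

lemma abs_component_le_znorm: "\<bar>real_of_int (m $ i)\<bar> \<le> znorm m"
  using component_le_norm_cart[of "\<chi> i. real_of_int (m $ i)" i] by (simp add: znorm_def)

lemma znorm_nonneg: "0 \<le> znorm m"
  by (simp add: znorm_def)

text \<open>The Japanese bracket of \<open>m\<close> to the power \<open>- N\<close>, written as a
  power of its square.\<close>

definition zweight :: "nat \<Rightarrow> int ^ 'd \<Rightarrow> real" where
  "zweight N m = (1 + (znorm m)\<^sup>2) powr (- real N / 2)"

lemma zweight_pos: "0 < zweight N m"
proof -
  have "0 < 1 + (znorm m)\<^sup>2" by (simp add: add_pos_nonneg)
  then show ?thesis unfolding zweight_def by (simp only: powr_gt_zero)
qed

text \<open>The exponent \<open>N\<close> is divided equally among the \<open>d\<close> coordinates.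
  Each share \<open>s = N / d\<close> exceeds 1, and replacing the norm by a single coordinate only
  enlarges the factor.\<close>

lemma zweight_summable:
  assumes "N > CARD('d)"
  shows "(zweight N :: int ^ 'd \<Rightarrow> real) summable_on UNIV"
proof -
  define s where "s = real N / real CARD('d)"
  have s: "1 < s" using assms by (simp add: s_def)
  let ?\<phi> = "\<lambda>m::int. (1 + (real_of_int m)\<^sup>2) powr (- s / 2)"
  have sum: "(\<lambda>m::int ^ 'd. \<Prod>i\<in>UNIV. ?\<phi> (m $ i)) summable_on UNIV"
    by (rule summable_on_prod_vec[OF summable_on_int_powr[OF s]]) simp
  have "zweight N m \<le> (\<Prod>i\<in>UNIV. ?\<phi> (m $ i))" for m :: "int ^ 'd"
  proof -
    have "0 < 1 + (znorm m)\<^sup>2" by (simp add: add_pos_nonneg)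
    then have pos: "1 + (znorm m)\<^sup>2 \<noteq> 0" by linarith
    have "zweight N m = (\<Prod>i\<in>(UNIV::'d set). (1 + (znorm m)\<^sup>2) powr (- s / 2))"
      using pos by (simp add: zweight_def s_def powr_power)
    also have "\<dots> \<le> (\<Prod>i\<in>UNIV. ?\<phi> (m $ i))"
    proof (intro prod_mono conjI)
      fix i
      have "(real_of_int (m $ i))\<^sup>2 \<le> (znorm m)\<^sup>2"
        using abs_component_le_znorm[of m i] znorm_nonneg[of m]
        by (metis abs_of_nonneg abs_le_square_iff)
      then show "(1 + (znorm m)\<^sup>2) powr (- s / 2) \<le> ?\<phi> (m $ i)"
        using s by (intro powr_mono2') (auto simp: add_pos_nonneg)
    qed simp
    finally show ?thesis .
  qed
  then show ?thesis
    by (rule summable_on_comparison_test[OF sum]) (simp add: zweight_pos less_imp_le)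
qed

text \<open>Rows and columns both run through all values of \<open>w\<close>, along
  \<open>k \<mapsto> j - k\<close> and \<open>k \<mapsto> k - j\<close> respectively, so one
  normalisation handles both.\<close>

lemma bistochastic_translation:
  fixes w :: "'i::ab_group_add \<Rightarrow> real"
  assumes w: "w summable_on UNIV" "\<And>m. 0 < w m"
  shows "0 < infsum w UNIV" and "bistochastic (\<lambda>j k. w (j - k) / infsum w UNIV)"
proof -
  have "w 0 \<le> infsum w UNIV"
    using finite_sum_le_infsum[OF w(1), of "{0}"] w(2) by (simp add: less_imp_le)
  then show pos: "0 < infsum w UNIV" using w(2)[of 0] by simp
  have "((\<lambda>m. w m / infsum w UNIV) has_sum infsum w UNIV / infsum w UNIV) UNIV"
    using w(1) by (intro has_sum_divide_const) simp
  then have 1: "((\<lambda>m. w m / infsum w UNIV) has_sum 1) UNIV" using pos by simp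
  have "bij (\<lambda>k. j - k)" and "bij (\<lambda>k. k - j)" for j :: 'i
    by (rule bijI', simp, metis diff_diff_eq2 add_diff_cancel_left')
      (rule bijI', simp, metis add_diff_cancel)
  then have "((\<lambda>k. w (j - k) / infsum w UNIV) has_sum 1) UNIV"
    "((\<lambda>k. w (k - j) / infsum w UNIV) has_sum 1) UNIV" for j
    using has_sum_reindex_bij_betw[of "\<lambda>k. j - k" UNIV UNIV "\<lambda>m. w m / infsum w UNIV" 1]
      has_sum_reindex_bij_betw[of "\<lambda>k. k - j" UNIV UNIV "\<lambda>m. w m / infsum w UNIV" 1] 1
    by auto
  then show "bistochastic (\<lambda>j k. w (j - k) / infsum w UNIV)"
    using pos w(2) by (simp add: bistochastic_def less_imp_le)
qed

text \<open>Each weight is at least the bracket of the sum to the power \<open>- N\<close>. This is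
  why the decay exponent is \<open>2 * N\<close>: half of it pays for each kernel factor.\<close>

lemma zweight_japanese_bracket_ge_1:
  fixes x y :: "int ^ 'd"
  shows "1 \<le> zweight N x * zweight N y * japanese_bracket (znorm x + znorm y) ^ (2 * N)"
proof -
  let ?a = "znorm x" and ?b = "znorm y"
  let ?s = "1 + (?a + ?b)\<^sup>2"
  have nn: "0 \<le> ?a" "0 \<le> ?b" by (simp_all add: znorm_nonneg)
  have pos: "0 < ?s" "0 < 1 + ?a\<^sup>2" "0 < 1 + ?b\<^sup>2" by (simp_all add: add_pos_nonneg)
  have "?a\<^sup>2 \<le> (?a + ?b)\<^sup>2" "?b\<^sup>2 \<le> (?a + ?b)\<^sup>2" using nn by (auto intro: power_mono)
  then have "?s powr (- real N / 2) \<le> zweight N x" "?s powr (- real N / 2) \<le> zweight N y"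
    unfolding zweight_def using pos by (auto intro!: powr_mono2')
  then have "?s powr (- real N / 2) * ?s powr (- real N / 2) \<le> zweight N x * zweight N y"
    by (intro mult_mono) (auto simp: zweight_pos less_imp_le)
  moreover have "japanese_bracket (?a + ?b) ^ (2 * N) = ?s powr real N"
    using pos by (simp add: japanese_bracket_def power_mult powr_realpow less_imp_le)
  moreover have "?s powr (- real N / 2) * ?s powr (- real N / 2) * ?s powr real N = 1"
    using pos by (simp flip: powr_add)
  ultimately show ?thesis by (metis mult_right_mono powr_ge_zero)
qed

section \<open>Finite lattice balls and sequences vanishing at infinity\<close>

lemma finite_znorm_less: "finite {m :: int ^ 'd. znorm m < R}"
proof (rule finite_subset)
  show "{m :: int ^ 'd. znorm m < R} \<subseteq> vec_lambda ` (UNIV \<rightarrow>\<^sub>E {- \<lceil>R\<rceil>..\<lceil>R\<rceil>})"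
  proof
    fix m :: "int ^ 'd" assume "m \<in> {m. znorm m < R}"
    then have "\<bar>real_of_int (m $ i)\<bar> < R" for i
      using abs_component_le_znorm[of m i] by simp
    then have "m $ i \<in> {- \<lceil>R\<rceil>..\<lceil>R\<rceil>}" for i
      by (smt (verit) atLeastAtMost_iff le_of_int_ceiling of_int_less_iff of_int_minus)
    then have "vec_nth m \<in> UNIV \<rightarrow>\<^sub>E {- \<lceil>R\<rceil>..\<lceil>R\<rceil>}" by auto
    moreover have "m = vec_lambda (vec_nth m)" by simp
    ultimately show "m \<in> vec_lambda ` (UNIV \<rightarrow>\<^sub>E {- \<lceil>R\<rceil>..\<lceil>R\<rceil>})" by blast
  qed
  show "finite (vec_lambda ` ((UNIV::'d set) \<rightarrow>\<^sub>E {- \<lceil>R\<rceil>..\<lceil>R\<rceil>}))"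
    by (intro finite_imageI finite_PiE) auto
qed

text \<open>Decay along the norm confines the superlevel set to a ball, which is finite. This is the
  form in which the compactness argument uses \<open>b\<close>.\<close>

lemma c0_seqs_finite_superlevel:
  assumes b: "b \<in> c0_seqs" and e: "0 < e"
  shows "finite {j. e \<le> norm (b j)}"
proof -
  have "eventually (\<lambda>j. dist (b j) 0 < e) (filtercomap znorm at_top)"
    using b e by (auto simp: c0_seqs_def tendsto_iff)
  then obtain R where "\<And>j. R \<le> znorm j \<Longrightarrow> dist (b j) 0 < e"
    by (auto simp: eventually_filtercomap_at_top_linorder)
  then have "{j. e \<le> norm (b j)} \<subseteq> {j. znorm j < R}"
    by (force simp: not_le[symmetric])
  then show ?thesis using finite_znorm_less by (rule finite_subset)
qed

theorem theorem4p2: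
  fixes \<Theta> :: "int ^ 'd \<Rightarrow> int ^ 'd \<Rightarrow> int ^ 'd \<Rightarrow> complex"
    and b :: "int ^ 'd \<Rightarrow> complex"
    and N :: nat
    and p q r :: ennreal
  assumes "N > CARD('d)"
    and "bdd_above (range (\<lambda>(j, k, l).
           norm (\<Theta> j k l) * japanese_bracket (znorm (j - k) + znorm (j - l)) ^ (2 * N)))"
    and "b \<in> c0_seqs"
    and "1 \<le> p" and "1 \<le> q" and "1 \<le> r" and "r < \<infinity>"
    and "1 / p + 1 / q = 1 / r"
  shows "(\<forall>f \<in> lp_space p. \<forall>g \<in> lp_space q. tensor_sums_converge \<Theta> f g) \<and>
    compact_bilinear_op (lp_space p) (lp_norm p) (lp_space q) (lp_norm q)
      (lp_space r) (lp_norm r) (commutator1 (tensor_op \<Theta>) b) \<and>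
    compact_bilinear_op (lp_space p) (lp_norm p) (lp_space q) (lp_norm q)
      (lp_space r) (lp_norm r) (commutator2 (tensor_op \<Theta>) b)"
proof -
  define W where "W = infsum (zweight N :: int ^ 'd \<Rightarrow> real) UNIV"
  let ?K = "\<lambda>j k :: int ^ 'd. zweight N (j - k) / W"
  note K = bistochastic_translation[OF zweight_summable[OF assms(1)] zweight_pos, folded W_def]
  obtain B where B: "norm (\<Theta> j k l) * japanese_bracket (znorm (j - k) + znorm (j - l)) ^ (2 * N) \<le> B" for j k l
    using assms(2) by (auto simp: bdd_above_def)
  have "0 \<le> norm (\<Theta> 0 0 0) * japanese_bracket (znorm (0 - 0 :: int ^ 'd) + znorm (0 - 0 :: int ^ 'd)) ^ (2 * N)"
    by (simp add: japanese_bracket_def)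
  with B[of 0 0 0] have B0: "0 \<le> B" by linarith
  then have C: "0 \<le> B * W\<^sup>2" by simp
  \<comment> \<open>The decay hypothesis is brought in by inserting a factor at least 1;
    \<open>W\<^sup>2\<close> compensates for the normalisation of the two kernels.\<close>
  have \<Theta>: "norm (\<Theta> j k l) \<le> B * W\<^sup>2 * (?K j k * ?K j l)" for j k l
  proof -
    let ?z = "zweight N (j - k) * zweight N (j - l)"
    let ?b = "japanese_bracket (znorm (j - k) + znorm (j - l)) ^ (2 * N)"
    have "norm (\<Theta> j k l) * 1 \<le> norm (\<Theta> j k l) * (?z * ?b)"
      by (rule mult_left_mono[OF zweight_japanese_bracket_ge_1]) simp
    also have "\<dots> = ?z * (norm (\<Theta> j k l) * ?b)" by (simp only: mult_ac)
    also have "\<dots> \<le> ?z * B"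
      by (intro mult_left_mono B) (simp add: zweight_pos less_imp_le)
    also have "\<dots> = B * W\<^sup>2 * (?K j k * ?K j l)"
      using K(1) by (simp add: power2_eq_square)
    finally show ?thesis by simp
  qed
  note b = c0_seqs_finite_superlevel[OF assms(3)]
  have "tensor_sums_converge \<Theta> f g" if f: "f \<in> lp_space p" and g: "g \<in> lp_space q" for f g
    by (rule tensor_sums_convergeI[OF K(2) C \<Theta> lp_norm_ge_coord[OF assms(4) f] lp_norm_ge_coord[OF assms(5) g]])
  then show ?thesis
    using commutator1_compact[OF K(2) C \<Theta> assms(4-8) b] commutator2_compact[OF K(2) C \<Theta> assms(4-8) b]
    by blast
qed

end
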